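(* Let $u$ and $v$ be distinct prime numbers, $n=uv$, $N=2^{uv}-1$, $\alpha$ a primitive element of $\mathbb{F}_{2^n}$, and let $C$ be the dual of the binary double-error-correcting BCH code of length $N$, $$C=\left\{\left(\mathrm{Tr}_{\mathbb{F}_{2^n}/\mathbb{F}_2}(\lambda\alpha^k+\beta\alpha^{3k})\right)_{0\le k\le N-1}:\lambda,\beta\in\mathbb{F}_{2^n}\right\}.$$ Let $L_2=\frac{2^{uv}-1}{2^u-1}$ and $L_3=\frac{2^{uv}-1}{2^v-1}$. Counting nonzero quasi-cyclic subcodes of $C$ of the form $C_{V,W}$ (see context), $C$ has $3$ cyclic subcodes (including itself) for any $u$ and $v$. Moreover: (i) If $u$ and $v$ are odd, then $C$ has $2N(v,2^u)+N(v,2^u)^2-3$ quasi-cyclic subcodes of index $L_2$ and $2N(u,2^v)+N(u,2^v)^2-3$ quasi-cyclic subcodes of index $L_3$. (ii) If $u=2$ and $v\ne 3$ is odd, then $C$ has $$N(uv,2)+N(v,2^u)+N(uv,2)N(v,2^u)-2N(u,2^v)-1$$ quasi-cyclic subcodes of index $L_2$, $N(u,2^v)^2-1$ quasi-cyclic subcodes of index $L_3$, and $2N(u,2^v)-2$ quasi-cyclic subcodes of index $L_3/3$. (iii) If $u=2$ and $v=3$, then $C$ has $124194$ quasi-cyclic subcodes of index $21$, $99$ of index $9$, $84$ of index $7$, and $18$ of index $3$.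
   Context: A linear code $D\subseteq\mathbb{F}_2^N$ is quasi-cyclic of index $\ell$ if it is invariant under cyclic shift of codewords by $\ell$ positions and $\ell$ is the smallest positive integer with this property; index $1$ means cyclic. The subcodes of $C$ considered are those of the form $$C_{V,W}=\left\{\left(\mathrm{Tr}_{\mathbb{F}_{2^n}/\mathbb{F}_2}(\lambda\alpha^k+\beta\alpha^{3k})\right)_{0\le k\le N-1}:\lambda\in V,\ \beta\in W\right\}$$ with $V,W$ $\mathbb{F}_2$-subspaces of $\mathbb{F}_{2^n}$ (one of them possibly $\{0\}$); the zero code is not counted. For a prime power $Q$ and $m\ge 1$, $N(m,Q)$ denotes the number of nonzero $\mathbb{F}_Q$-subspaces of an $m$-dimensional $\mathbb{F}_Q$-vector space: $$N(m,Q)=\sum_{k=1}^{m}\frac{(Q^m-1)(Q^m-Q)\cdots(Q^m-Q^{k-1})}{(Q^k-1)(Q^k-Q)\cdots(Q^k-Q^{k-1})}.$$ *)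

theory Defs
  imports "HOL-Computational_Algebra.Computational_Algebra" "HOL-Library.Z2" "HOL-Library.Cardinality"
begin

text \<open>
  The field with $2^n$ elements is a type of class \<open>finite_field\<close> with \<open>CARD('a) = 2 ^ n\<close>.
  The field with two elements is the library type \<^typ>\<open>bit\<close>; its embedding into a field of
  characteristic 2 is \<open>of_bit\<close>.  Words of length $N$ over it are lists of length $N$, and the
  cyclic shift by $l$ positions is \<^const>\<open>rotate\<close>.
\<close>

definition primitive_elem :: "'a::finite_field \<Rightarrow> bool" where
  "primitive_elem \<alpha> \<longleftrightarrow> range (\<lambda>k::nat. \<alpha> ^ k) = UNIV - {0}"

text \<open>
  The trace to the prime field is the sum of the $n$ conjugates; that this sum lies in the
  prime field, so that the description is proper, is \<open>of_bit_trace2\<close> below.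
\<close>

definition trace2 :: "nat \<Rightarrow> 'a::finite_field \<Rightarrow> bit" where
  "trace2 n x = (THE b. of_bit b = (\<Sum>i<n. x ^ (2 ^ i)))"

definition bit_scale :: "bit \<Rightarrow> 'a::finite_field \<Rightarrow> 'a" where
  "bit_scale c x = of_bit c * x"

definition bit_subspace :: "'a::finite_field set \<Rightarrow> bool" where
  "bit_subspace = module.subspace bit_scale"

definition linear_code :: "nat \<Rightarrow> bit list set \<Rightarrow> bool" where
  "linear_code N D \<longleftrightarrow>
     (\<forall>c\<in>D. length c = N) \<and> replicate N 0 \<in> D \<and>
     (\<forall>c\<in>D. \<forall>d\<in>D. map2 (+) c d \<in> D) \<and> (\<forall>a. \<forall>c\<in>D. map ((*) a) c \<in> D)"

definition shift_invariant :: "nat \<Rightarrow> bit list set \<Rightarrow> bool" where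
  "shift_invariant l D \<longleftrightarrow> (\<forall>c\<in>D. rotate l c \<in> D)"

definition quasi_cyclic_index :: "nat \<Rightarrow> nat \<Rightarrow> bit list set \<Rightarrow> bool" where
  "quasi_cyclic_index N l D \<longleftrightarrow>
     linear_code N D \<and> 0 < l \<and> shift_invariant l D \<and>
     (\<forall>m. 0 < m \<and> m < l \<longrightarrow> \<not> shift_invariant m D)"

definition codeword :: "nat \<Rightarrow> 'a::finite_field \<Rightarrow> 'a \<Rightarrow> 'a \<Rightarrow> bit list" where
  "codeword n \<alpha> a b = map (\<lambda>k. trace2 n (a * \<alpha> ^ k + b * \<alpha> ^ (3 * k))) [0..<2 ^ n - 1]"

definition dual_bch :: "nat \<Rightarrow> 'a::finite_field \<Rightarrow> bit list set" where
  "dual_bch n \<alpha> = {codeword n \<alpha> a b | a b. True}"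

definition subcode :: "nat \<Rightarrow> 'a::finite_field \<Rightarrow> 'a set \<Rightarrow> 'a set \<Rightarrow> bit list set" where
  "subcode n \<alpha> V W = {codeword n \<alpha> a b | a b. a \<in> V \<and> b \<in> W}"

definition qc_subcodes :: "nat \<Rightarrow> 'a::finite_field \<Rightarrow> nat \<Rightarrow> bit list set set" where
  "qc_subcodes n \<alpha> l =
     {D. (\<exists>V W. bit_subspace V \<and> bit_subspace W \<and> D = subcode n \<alpha> V W) \<and>
         D \<subseteq> dual_bch n \<alpha> \<and> D \<noteq> {replicate (2 ^ n - 1) 0} \<and>
         quasi_cyclic_index (2 ^ n - 1) l D}"

text \<open>
  The number of nonzero subspaces of an $m$-dimensional space over the field with $Q$ elements,
  given by its closed formula; rational-valued, so that subtraction and division are the usual ones.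
\<close>

definition num_subspaces :: "nat \<Rightarrow> nat \<Rightarrow> rat" where
  "num_subspaces m Q =
     (\<Sum>k = 1..m. (\<Prod>i<k. of_nat Q ^ m - of_nat Q ^ i) / (\<Prod>i<k. of_nat Q ^ k - of_nat Q ^ i))"

lemma CHAR_eq_2:
  assumes "CARD('a::finite_field) = 2 ^ n"
  shows "CHAR('a) = 2"
proof -
  have "n \<noteq> 0"
  proof
    assume "n = 0"
    hence "is_singleton (UNIV :: 'a set)" using assms by (simp add: is_singleton_altdef)
    thus False by (metis UNIV_I is_singletonE singletonD zero_neq_one)
  qed
  hence "(-1 :: 'a) ^ (2 ^ n) = 1" by simp
  hence "(-1 :: 'a) = 1" using finite_field_power_card_eq_same[of "-1 :: 'a"] assms by simp
  hence "of_nat 2 = (0::'a)" by (metis add.right_inverse of_nat_1 of_nat_add one_add_one)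
  hence "CHAR('a) dvd 2" by (simp only: of_nat_eq_0_iff_char_dvd)
  thus ?thesis
    using prime_CHAR_semidom[where ?'a = 'a] CHAR_pos[where ?'a = 'a]
    by (auto simp: primes_dvd_imp_eq)
qed

lemma of_bit_trace2:
  fixes x :: "'a::finite_field"
  assumes card: "CARD('a) = 2 ^ n"
  shows "of_bit (trace2 n x) = (\<Sum>i<n. x ^ (2 ^ i))"
proof -
  define s where "s = (\<Sum>i<n. x ^ (2 ^ i))"
  note char = CHAR_eq_2[OF card]
  have "prime CHAR('a)" by (simp add: char)
  hence "s ^ 2 = (\<Sum>i<n. (x ^ (2 ^ i)) ^ 2)"
    unfolding s_def by (rule freshmans_dream_sum) (simp add: char)
  also have "\<dots> = (\<Sum>i<n. x ^ (2 ^ Suc i))"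
    by (simp only: power_mult [symmetric] power_Suc2)
  also have "\<dots> = (\<Sum>i<Suc n. x ^ (2 ^ i)) - x"
    by (subst sum.lessThan_Suc_shift) (simp only: power_0 power_one_right add_diff_cancel_left')
  also have "\<dots> = s"
    using finite_field_power_card_eq_same[of x] by (simp only: sum.lessThan_Suc s_def card) simp
  finally have "s * (s - 1) = 0" by (simp add: power2_eq_square right_diff_distrib)
  hence "s = 0 \<or> s = 1" by simp
  hence ex: "\<exists>b. of_bit b = s" by (auto intro: exI[of _ 0] exI[of _ 1])
  have "\<exists>!b. of_bit b = s"
  proof (rule ex_ex1I[OF ex])
    fix b c :: bit assume "of_bit b = s" "of_bit c = s"
    hence "(of_bit b :: 'a) = of_bit c" by simp
    thus "b = c" by (cases b; cases c) auto
  qed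
  thus ?thesis unfolding trace2_def s_def by (rule theI')
qed

lemma module_bit_scale:
  assumes "CARD('a::finite_field) = 2 ^ n"
  shows "module (bit_scale :: bit \<Rightarrow> 'a \<Rightarrow> 'a)"
proof -
  have two: "(1::'a) + 1 = 0"
    using of_nat_CHAR[where ?'a = 'a] by (simp add: CHAR_eq_2[OF assms])
  have add: "(of_bit (a + b) :: 'a) = of_bit a + of_bit b" for a b
    using two by (cases a; cases b) auto
  show ?thesis
    by standard (simp_all only: bit_scale_def add distrib_left distrib_right,
       auto simp: of_bool_def)
qed

end

theory Submission
  imports Defs
begin

text \<open>
  Since the trace form is nondegenerate, polarization of the cubic term shows that the pair
  $(V,W)$ is determined by the subcode $C_{V,W}$.  Shifting by $l$ replaces $(V,W)$ by
  $(\alpha^l V, \alpha^{3l} W)$, so $C_{V,W}$ is invariant iff $\alpha^l$ and $\alpha^{3l}$ lie in the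
  multiplier rings of $V$ and $W$.  These are subfields $\mathbb{F}_{2^d}$, $\mathbb{F}_{2^e}$ with
  $d, e \mid n$, and the index is the least common multiple of $M_d$ and $M_e/\gcd(3,M_e)$, where
  $M_d = (2^n-1)/(2^d-1)$.  The subspaces with multiplier ring exactly $\mathbb{F}_{2^d}$ are
  counted by sieving the $\mathbb{F}_{2^d}$-subspaces along the divisors $1, u, v, uv$ of $n$;
  only $u = 2$ makes $3$ divide $2^n - 1$, and then $9$ divides it only for $v = 3$.
\<close>

section \<open>Counting the subspaces over a subfield\<close>

text \<open>All asymmetry comes from the cubing in the second coordinate: V has to absorb
  \<alpha>^l, but W only \<alpha>^(3l), so a factor 3 of M_e can get lost and equal multiplier
  fields can force different periods. When 3 does not divide N the two coordinates behave alike,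
  which makes the odd case symmetric in u and v. The small constants in the counts come from
  degenerate subspaces: {0} and the whole field both have the whole field as multiplier ring, so the
  top class has two members, and the four pairs formed from it are exactly those of index 1. One of
  these is ({0},{0}), the zero code, which is not counted; hence 3 cyclic subcodes. As n has only
  the divisors 1, u, v, uv, the sieve is a triangular system solved from the top divisor
  downwards.\<close>

definition is_subfield :: "'a::finite_field set \<Rightarrow> bool" where
  "is_subfield K \<longleftrightarrow>
     0 \<in> K \<and> 1 \<in> K \<and> (\<forall>x\<in>K. \<forall>y\<in>K. x + y \<in> K) \<and> (\<forall>x\<in>K. \<forall>y\<in>K. x * y \<in> K)"

definition subspaces :: "'a::finite_field set \<Rightarrow> 'a set set" where
  "subspaces K =
     {V. 0 \<in> V \<and> (\<forall>x\<in>V. \<forall>y\<in>V. x + y \<in> V) \<and> (\<forall>c\<in>K. \<forall>x\<in>V. c * x \<in> V)}"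

lemma subspacesD:
  assumes "V \<in> subspaces K"
  shows "0 \<in> V" "x \<in> V \<Longrightarrow> y \<in> V \<Longrightarrow> x + y \<in> V" "c \<in> K \<Longrightarrow> x \<in> V \<Longrightarrow> c * x \<in> V"
  using assms by (auto simp: subspaces_def)

locale subfield =
  fixes K :: "'a::finite_field set"
  assumes is_subfield: "is_subfield K"
begin

lemma zero: "0 \<in> K" and one: "1 \<in> K"
  and add: "x \<in> K \<Longrightarrow> y \<in> K \<Longrightarrow> x + y \<in> K"
  and mult: "x \<in> K \<Longrightarrow> y \<in> K \<Longrightarrow> x * y \<in> K"
  using is_subfield by (auto simp: is_subfield_def)

text \<open>In positive characteristic -1 is a natural multiple of 1, so closure under addition
  already yields negation.\<close>

lemma uminus_one: "-1 \<in> K"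
proof -
  have "of_nat k \<in> K" for k
    by (induction k) (auto intro: zero one add)
  moreover have "(-1 :: 'a) = of_nat (CHAR('a) - 1)"
    using CHAR_pos[where ?'a = 'a] by (simp add: of_nat_diff Suc_leI)
  ultimately show ?thesis by simp
qed

lemma diff: "x \<in> K \<Longrightarrow> y \<in> K \<Longrightarrow> x - y \<in> K"
  using add[of x "(-1) * y"] mult[OF uminus_one, of y] by simp

lemma power: "x \<in> K \<Longrightarrow> x ^ k \<in> K"
  by (induction k) (auto intro: one mult)

text \<open>In a field of q + 2 elements, \<open>x ^ (q + 2) = x\<close> makes \<open>x ^ q\<close>
  the inverse of a nonzero \<open>x\<close>.\<close>

lemma inverse: assumes "x \<in> K" shows "inverse x \<in> K"
proof (cases "x = 0")
  case False
  have "CARD('a) \<ge> 2"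
    using card_mono[of UNIV "{0, 1 :: 'a}"] by simp
  then obtain q where q: "CARD('a) = Suc (Suc q)"
    by (metis Suc_le_D numeral_2_eq_2 Suc_le_mono)
  have "x * (x * x ^ q) = x"
    using finite_field_power_card_eq_same[of x] by (simp add: q)
  hence "x * x ^ q = 1" using False by simp
  hence "inverse x = x ^ q" by (rule inverse_unique)
  thus ?thesis using assms by (simp add: power)
qed (use zero in auto)

lemma card_ge_2: "2 \<le> card K"
  using card_mono[of K "{0, 1}"] zero one by simp

lemma card_power_inj: "card K ^ i = card K ^ j \<longleftrightarrow> i = j"
  using card_ge_2 by (intro power_inject_exp) auto

section \<open>Spans, independent lists and bases\<close>

primrec lspan :: "'a list \<Rightarrow> 'a set" where
  "lspan [] = {0}"
| "lspan (x # xs) = (\<lambda>(c, y). c * x + y) ` (K \<times> lspan xs)"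

text \<open>Each entry is compared only with the span of the entries after it, so lists are extended
  at the head and the possible extensions are the complement of one span.\<close>

primrec indep :: "'a list \<Rightarrow> bool" where
  "indep [] \<longleftrightarrow> True"
| "indep (x # xs) \<longleftrightarrow> indep xs \<and> x \<notin> lspan xs"

lemma subspace_lspan: "lspan xs \<in> subspaces K"
proof (induction xs)
  case Nil
  show ?case by (simp add: subspaces_def)
next
  case (Cons x xs)
  note IH = subspacesD[OF Cons.IH]
  have mem: "c \<in> K \<Longrightarrow> y \<in> lspan xs \<Longrightarrow> c * x + y \<in> lspan (x # xs)" for c y
    by force
  have "(c * x + y) + (c' * x + y') \<in> lspan (x # xs)"
    if "c \<in> K" "c' \<in> K" "y \<in> lspan xs" "y' \<in> lspan xs" for c c' y y'
    using mem[of "c + c'" "y + y'"] that by (simp add: add IH(2) algebra_simps)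
  moreover have "d * (c * x + y) \<in> lspan (x # xs)"
    if "c \<in> K" "d \<in> K" "y \<in> lspan xs" for c d y
    using mem[of "d * c" "d * y"] that by (simp add: mult IH(3) algebra_simps)
  moreover have "0 \<in> lspan (x # xs)"
    using mem[of 0 0] zero IH(1) by simp
  ultimately show ?case
    by (auto simp: subspaces_def simp del: lspan.simps(2) elim!: rev_image_eqI)
       (auto simp: subspaces_def)
qed

lemma lspan_subset: "V \<in> subspaces K \<Longrightarrow> set xs \<subseteq> V \<Longrightarrow> lspan xs \<subseteq> V"
  by (induction xs) (auto intro!: subspacesD[of V K])

lemma set_subset_lspan: "set xs \<subseteq> lspan xs"
proof (induction xs)
  case (Cons x xs)
  have "c \<in> K \<Longrightarrow> y \<in> lspan xs \<Longrightarrow> c * x + y \<in> lspan (x # xs)" for c y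
    by force
  from this[of 1 0] this[of 0] show ?case
    using Cons zero one subspacesD(1)[OF subspace_lspan] by auto
qed simp

text \<open>Coordinates are unique: two expressions with different coefficients of \<open>x\<close>
  would put \<open>x\<close> into the span of the tail. Each entry thus contributes a factor
  \<open>card K\<close>.\<close>

lemma card_lspan: "indep xs \<Longrightarrow> card (lspan xs) = card K ^ length xs"
proof (induction xs)
  case (Cons x xs)
  note S = subspacesD[OF subspace_lspan[of xs]]
  have "inj_on (\<lambda>(c, y). c * x + y) (K \<times> lspan xs)"
  proof (rule inj_onI, clarsimp)
    fix c y d z
    assume *: "c \<in> K" "d \<in> K" "y \<in> lspan xs" "z \<in> lspan xs" "c * x + y = d * x + z"
    have "c = d"
    proof (rule ccontr)
      assume ne: "c \<noteq> d"
      have "(c - d) * x = z + (-1) * y" using *(5) by (simp add: algebra_simps)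
      hence "x = inverse (c - d) * (z + (-1) * y)"
        using ne by (simp add: field_simps)
      moreover have "inverse (c - d) * (z + (-1) * y) \<in> lspan xs"
        using * by (intro S inverse diff uminus_one)
      ultimately show False using Cons.prems by simp
    qed
    thus "c = d \<and> y = z" using *(5) by simp
  qed
  thus ?case using Cons by (simp add: card_image card_cartesian_product)
qed simp

section \<open>Gaussian binomial coefficients\<close>

definition indep_lists :: "nat \<Rightarrow> 'a set \<Rightarrow> 'a list set" where
  "indep_lists k V = {xs. length xs = k \<and> set xs \<subseteq> V \<and> indep xs}"

lemma finite_indep_lists: "finite (indep_lists k V)"
  by (rule finite_subset[OF _ finite_lists_length_eq[of UNIV k]]) (auto simp: indep_lists_def)

text \<open>A list of length i has \<open>card K ^ m - card K ^ i\<close> extensions. Over the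
  rationals the formula also covers k > m, where the factor i = m vanishes and no such list
  exists.\<close>

lemma card_indep_lists:
  assumes V: "V \<in> subspaces K" and m: "card V = card K ^ m"
  shows "(of_nat (card (indep_lists k V)) :: rat) =
         (\<Prod>i<k. of_nat (card K) ^ m - of_nat (card K) ^ i)"
proof (induction k)
  case 0
  have "indep_lists 0 V = {[]}" by (auto simp: indep_lists_def)
  thus ?case by simp
next
  case (Suc k)
  have eq: "indep_lists (Suc k) V =
              (\<lambda>(xs, x). x # xs) ` (SIGMA xs:indep_lists k V. V - lspan xs)"
    by (force simp: indep_lists_def length_Suc_conv image_iff)
  have "card (indep_lists (Suc k) V) = card (SIGMA xs:indep_lists k V. V - lspan xs)"
    unfolding eq by (rule card_image) (auto simp: inj_on_def)
  also have "\<dots> = (\<Sum>xs\<in>indep_lists k V. card (V - lspan xs))"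
    by (simp add: finite_indep_lists)
  finally have "(of_nat (card (indep_lists (Suc k) V)) :: rat) =
      (\<Sum>xs\<in>indep_lists k V. of_nat (card (V - lspan xs)))" by simp
  also have "\<dots> = (\<Sum>xs\<in>indep_lists k V. of_nat (card K) ^ m - of_nat (card K) ^ k)"
  proof (rule sum.cong[OF refl])
    fix xs assume xs: "xs \<in> indep_lists k V"
    hence sub: "lspan xs \<subseteq> V" using lspan_subset[OF V] by (simp add: indep_lists_def)
    have c: "card (lspan xs) = card K ^ k" using xs card_lspan by (auto simp: indep_lists_def)
    show "(of_nat (card (V - lspan xs)) :: rat) = of_nat (card K) ^ m - of_nat (card K) ^ k"
      using card_mono[OF _ sub] by (simp add: card_Diff_subset sub c m of_nat_diff)
  qed
  finally show ?case using Suc.IH by simp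
qed

text \<open>An independent list in \<open>V\<close> of maximal length spans \<open>V\<close>, since
  a vector outside its span could be prepended.\<close>

lemma subspace_basis:
  assumes V: "V \<in> subspaces K"
  obtains xs where "indep xs" "lspan xs = V"
proof -
  define P where "P xs \<longleftrightarrow> set xs \<subseteq> V \<and> indep xs" for xs
  \<comment> \<open>Maximal length makes sense because an independent list of length k spans at
    least 2^k > k vectors of \<open>V\<close>.\<close>
  have bound: "length xs < Suc (card V)" if "P xs" for xs
  proof -
    have "length xs < 2 ^ length xs" by simp
    also have "\<dots> \<le> card K ^ length xs" using card_ge_2 by (rule power_mono) simp
    also have "\<dots> = card (lspan xs)" using that card_lspan by (simp add: P_def)
    also have "\<dots> \<le> card V" using that V by (intro card_mono lspan_subset) (auto simp: P_def)
    finally show ?thesis by simp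
  qed
  have "P []" by (simp add: P_def)
  then obtain xs where xs: "P xs" "\<And>ys. P ys \<Longrightarrow> length ys \<le> length xs"
    using ex_has_greatest_nat[of P "[]" length "Suc (card V)"] bound by (metis order_less_imp_le)
  have "V \<subseteq> lspan xs"
  proof
    fix x assume x: "x \<in> V"
    show "x \<in> lspan xs"
    proof (rule ccontr)
      assume "x \<notin> lspan xs"
      hence "P (x # xs)" using xs x by (simp add: P_def)
      from xs(2)[OF this] show False by simp
    qed
  qed
  moreover have "lspan xs \<subseteq> V" using xs lspan_subset[OF V] by (simp add: P_def)
  ultimately show thesis using xs that by (auto simp: P_def)
qed

lemma card_subspace: "V \<in> subspaces K \<Longrightarrow> \<exists>k. card V = card K ^ k"
  by (metis subspace_basis card_lspan)

text \<open>Double counting: the independent lists of length k are partitioned by their spans, and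
  every k-dimensional subspace receives as many of them as it has ordered bases.\<close>

lemma card_subspaces_dim:
  assumes "CARD('a) = card K ^ m"
  shows "(of_nat (card {V \<in> subspaces K. card V = card K ^ k}) :: rat) =
    (\<Prod>i<k. of_nat (card K) ^ m - of_nat (card K) ^ i) /
    (\<Prod>i<k. of_nat (card K) ^ k - of_nat (card K) ^ i)"
proof -
  let ?S = "{V \<in> subspaces K. card V = card K ^ k}"
  have UN: "indep_lists k UNIV = (\<Union>V\<in>?S. indep_lists k V)"
  proof (intro equalityI subsetI)
    fix xs assume "xs \<in> indep_lists k UNIV"
    hence "lspan xs \<in> ?S" "xs \<in> indep_lists k (lspan xs)"
      using card_lspan[of xs] subspace_lspan[of xs] set_subset_lspan[of xs]
      by (auto simp: indep_lists_def)
    thus "xs \<in> (\<Union>V\<in>?S. indep_lists k V)" by blast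
  qed (auto simp: indep_lists_def)
  have span: "lspan xs = V" if "V \<in> ?S" "xs \<in> indep_lists k V" for V xs
    using that card_lspan[of xs] by (intro card_subset_eq lspan_subset) (auto simp: indep_lists_def)
  have "card (indep_lists k UNIV) = (\<Sum>V\<in>?S. card (indep_lists k V))"
    unfolding UN
  proof (rule card_UN_disjoint)
    show "\<forall>V\<in>?S. \<forall>V'\<in>?S. V \<noteq> V' \<longrightarrow> indep_lists k V \<inter> indep_lists k V' = {}"
      using span by blast
  qed (auto simp: finite_indep_lists)
  hence "(of_nat (card (indep_lists k UNIV)) :: rat) = (\<Sum>V\<in>?S. of_nat (card (indep_lists k V)))"
    by simp
  also have "\<dots> = (\<Sum>V\<in>?S. \<Prod>i<k. of_nat (card K) ^ k - of_nat (card K) ^ i)"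
    by (rule sum.cong[OF refl]) (simp add: card_indep_lists)
  also have "\<dots> = of_nat (card ?S) * (\<Prod>i<k. of_nat (card K) ^ k - of_nat (card K) ^ i)"
    by simp
  finally have "of_nat (card ?S) * (\<Prod>i<k. of_nat (card K) ^ k - of_nat (card K) ^ i) =
      (\<Prod>i<k. of_nat (card K) ^ m - of_nat (card K) ^ i :: rat)"
    by (subst (asm) card_indep_lists[where m = m]) (auto simp: assms subspaces_def)
  moreover have "(\<Prod>i<k. of_nat (card K) ^ k - of_nat (card K) ^ i :: rat) \<noteq> 0"
    using card_power_inj[of k] by (auto simp flip: of_nat_power)
  ultimately show ?thesis by (simp add: field_simps)
qed

text \<open>The extra 1 is the zero subspace, since \<open>num_subspaces\<close> starts at dimension
  1.\<close>

lemma card_subspaces: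
  assumes m: "CARD('a) = card K ^ m"
  shows "of_nat (card (subspaces K)) = num_subspaces m (card K) + 1"
proof -
  let ?S = "\<lambda>k. {V \<in> subspaces K. card V = card K ^ k}"
  have "subspaces K = (\<Union>k\<in>{0..m}. ?S k)"
  proof (intro equalityI subsetI)
    fix V assume V: "V \<in> subspaces K"
    then obtain k where k: "card V = card K ^ k" using card_subspace by blast
    have "card K ^ k \<le> card K ^ m" using card_mono[of UNIV V] by (simp add: k m)
    hence "k \<le> m" using card_ge_2 by (subst (asm) power_increasing_iff) auto
    thus "V \<in> (\<Union>k\<in>{0..m}. ?S k)" using V k by auto
  qed auto
  hence "card (subspaces K) = card (\<Union>k\<in>{0..m}. ?S k)" by simp
  also have "\<dots> = (\<Sum>k\<in>{0..m}. card (?S k))"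
    by (rule card_UN_disjoint) (auto simp: card_power_inj)
  finally have "(of_nat (card (subspaces K)) :: rat) = (\<Sum>k\<in>{0..m}. of_nat (card (?S k)))" by simp
  also have "\<dots> = num_subspaces m (card K) + 1"
    unfolding card_subspaces_dim[OF m] num_subspaces_def
    by (subst sum.atLeast_Suc_atMost) auto
  finally show ?thesis .
qed

end

section \<open>The subfields of a finite field of characteristic two\<close>

lemma one_less_two_power: "0 < a \<Longrightarrow> 1 < (2::nat) ^ a"
  by (rule one_less_power) simp_all

text \<open>Euclid's algorithm on the exponents: for b = a + c, 2^b - 1 = 2^c (2^a - 1) + (2^c - 1),
  so b may be replaced by c.\<close>

lemma mersenne_dvd_mersenne_iff:
  fixes a b :: nat
  assumes "0 < a"
  shows "2 ^ a - 1 dvd 2 ^ b - (1::nat) \<longleftrightarrow> a dvd b"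
proof (induction b rule: less_induct)
  case (less b)
  show ?case
  proof (cases "b < a")
    case True
    hence "2 ^ b < (2::nat) ^ a" by simp
    moreover have "1 \<le> (2::nat) ^ b" by simp
    ultimately have lt: "2 ^ b - 1 < 2 ^ a - (1::nat)" by linarith
    show ?thesis
    proof (cases "b = 0")
      case False
      hence "1 < (2::nat) ^ b" by (intro one_less_two_power) simp
      hence "0 < 2 ^ b - (1::nat)" by linarith
      thus ?thesis using lt True False by (meson dvd_imp_le gr0I not_le)
    qed simp
  next
    case False
    then obtain c where c: "b = a + c" using le_Suc_ex not_less by blast
    have "1 \<le> (2::nat) ^ a" "1 \<le> (2::nat) ^ c" by simp_all
    hence "2 ^ b - 1 = 2 ^ c * (2 ^ a - 1) + (2 ^ c - (1::nat))"
      by (simp add: c power_add algebra_simps)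
    hence "2 ^ a - 1 dvd 2 ^ b - (1::nat) \<longleftrightarrow> 2 ^ a - 1 dvd 2 ^ c - (1::nat)"
      by (simp only:) (rule dvd_add_right_iff, simp)
    also have "\<dots> \<longleftrightarrow> a dvd c" using assms by (intro less) (simp add: c)
    finally show ?thesis by (simp add: c)
  qed
qed

text \<open>The multiplier ring of \<open>V\<close>; for \<open>V = {0}\<close> it is the whole
  field.\<close>

definition stab :: "'a::finite_field set \<Rightarrow> 'a set" where
  "stab V = {x. \<forall>y\<in>V. x * y \<in> V}"

text \<open>Recognizes the subspaces over a larger field among the binary ones, so a single
  classification by multiplier ring serves every scalar field.\<close>

lemma subspaces_iff_stab: "K \<subseteq> L \<Longrightarrow> V \<in> subspaces L \<longleftrightarrow> V \<in> subspaces K \<and> L \<subseteq> stab V"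
  by (auto simp: subspaces_def stab_def)

section \<open>Powers of a primitive element\<close>

text \<open>In the field of four elements every nonzero cube is 1 and different coefficient pairs
  can give the same codeword; \<open>2 < n\<close> rules this out.\<close>

locale primitive_field =
  fixes \<alpha> :: "'a::finite_field" and n :: nat
  assumes card_UNIV: "CARD('a) = 2 ^ n" and primitive: "primitive_elem \<alpha>" and n_gt: "2 < n"
begin

definition N :: nat where "N = 2 ^ n - 1"

lemma CHAR: "CHAR('a) = 2"
  by (rule CHAR_eq_2[OF card_UNIV])

lemma prime_CHAR: "prime CHAR('a)"
  by (simp add: CHAR)

lemma uminus_same: "-(x::'a) = x" and minus_eq_plus: "x - y = x + (y::'a)"
  by (rule uminus_CHAR_2[OF CHAR], rule minus_CHAR_2[OF CHAR])

lemma N_pos: "0 < N"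
  using n_gt one_less_two_power[of n] by (simp add: N_def)

lemma power_card: "x ^ (2 ^ n) = (x::'a)"
  using finite_field_power_card_eq_same[of x] by (simp add: card_UNIV)

lemma \<alpha>_nonzero: "\<alpha> \<noteq> 0"
  using primitive unfolding primitive_elem_def
  by (metis (mono_tags, lifting) DiffD2 power_one_right rangeI singletonI)

lemma \<alpha>_power_N: "\<alpha> ^ N = 1"
proof -
  have "\<alpha> * \<alpha> ^ N = \<alpha>"
    using power_card[of \<alpha>] by (simp add: N_def flip: power_Suc)
  thus ?thesis using \<alpha>_nonzero by simp
qed

lemma \<alpha>_power_mod: "\<alpha> ^ (k mod N) = \<alpha> ^ k"
proof -
  have "\<alpha> ^ k = \<alpha> ^ (N * (k div N) + k mod N)" by simp
  also have "\<dots> = \<alpha> ^ (k mod N)"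
    by (simp only: power_add power_mult \<alpha>_power_N power_one mult_1)
  finally show ?thesis by simp
qed

lemma nonzero_power: assumes "x \<noteq> 0" obtains k where "k < N" "x = \<alpha> ^ k"
proof -
  have "x \<in> range (\<lambda>k. \<alpha> ^ k)" using primitive assms by (simp add: primitive_elem_def)
  then obtain k where "x = \<alpha> ^ k" by blast
  thus thesis using that[of "k mod N"] N_pos \<alpha>_power_mod by simp
qed

text \<open>If 1 were reached at a remainder 0 < r < N, the powers would take at most r values, too
  few for the N nonzero elements.\<close>

lemma \<alpha>_power_eq_1_iff: "\<alpha> ^ k = 1 \<longleftrightarrow> N dvd k"
proof
  assume "N dvd k"
  thus "\<alpha> ^ k = 1" using \<alpha>_power_N by (auto simp: power_mult)
next
  assume k: "\<alpha> ^ k = 1"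
  define r where "r = k mod N"
  have r: "\<alpha> ^ r = 1" "r < N" using k N_pos by (auto simp: r_def \<alpha>_power_mod)
  have "r = 0"
  proof (rule ccontr)
    assume "r \<noteq> 0"
    have "UNIV - {0} \<subseteq> (\<lambda>k. \<alpha> ^ k) ` {..<r}"
    proof
      fix x :: 'a assume "x \<in> UNIV - {0}"
      then obtain j where j: "x = \<alpha> ^ j" using nonzero_power by blast
      have "\<alpha> ^ j = \<alpha> ^ (r * (j div r) + j mod r)" by simp
      also have "\<dots> = \<alpha> ^ (j mod r)"
        by (simp only: power_add power_mult r power_one mult_1)
      finally show "x \<in> (\<lambda>k. \<alpha> ^ k) ` {..<r}" using j \<open>r \<noteq> 0\<close> by auto
    qed
    hence "card (UNIV - {0::'a}) \<le> card ((\<lambda>k. \<alpha> ^ k) ` {..<r})" by (intro card_mono) auto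
    also have "\<dots> \<le> r" using card_image_le[of "{..<r}"] by simp
    finally show False using r by (simp add: card_Diff_singleton card_UNIV N_def)
  qed
  thus "N dvd k" by (simp add: r_def mod_eq_0_iff_dvd)
qed

lemma \<alpha>_power_eq_iff: "i < N \<Longrightarrow> j < N \<Longrightarrow> \<alpha> ^ i = \<alpha> ^ j \<longleftrightarrow> i = j"
proof (induction i j rule: linorder_wlog)
  case (le i j)
  show ?case
  proof
    assume "\<alpha> ^ i = \<alpha> ^ j"
    also have "\<alpha> ^ j = \<alpha> ^ i * \<alpha> ^ (j - i)" using le by (simp flip: power_add)
    finally have "\<alpha> ^ (j - i) = 1" using \<alpha>_nonzero by simp
    hence "N dvd j - i" by (simp only: \<alpha>_power_eq_1_iff)
    moreover have "j - i < N" using le by simp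
    ultimately have "j - i = 0" by (meson dvd_imp_le gr0I not_le)
    thus "i = j" using le by simp
  qed simp
qed auto

section \<open>Subfields as fixed points of Frobenius powers\<close>

definition sf :: "nat \<Rightarrow> 'a set" where "sf d = {x. x ^ (2 ^ d) = x}"

text \<open>For d dividing n, the index of the multiplicative group of \<open>sf d\<close> in that
  of the whole field; \<alpha>^(M d) generates the former.\<close>

definition M :: "nat \<Rightarrow> nat" where "M d = N div (2 ^ d - 1)"

lemma dvd_n_pos: "d dvd n \<Longrightarrow> 0 < d"
  using n_gt by (auto intro: Nat.gr0I)

lemma M_mult: assumes "d dvd n" shows "M d * (2 ^ d - 1) = N"
  unfolding M_def N_def using mersenne_dvd_mersenne_iff[OF dvd_n_pos[OF assms], of n] assms
  by (simp only: dvd_div_mult_self)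

lemma is_subfield_sf: "is_subfield (sf d)"
  using freshmans_dream'[OF prime_CHAR, of "2 ^ d" d]
  by (auto simp: is_subfield_def sf_def power_mult_distrib power_0_left CHAR)

lemma zero_sf: "0 \<in> sf d"
  using is_subfield_sf[of d] by (simp add: is_subfield_def)

lemma \<alpha>_power_sf_iff: assumes "d dvd n" shows "\<alpha> ^ k \<in> sf d \<longleftrightarrow> M d dvd k"
proof -
  have pos: "0 < 2 ^ d - (1::nat)" using one_less_two_power[OF dvd_n_pos[OF assms]] by simp
  have "(\<alpha> ^ k) ^ (2 ^ d) = \<alpha> ^ k * \<alpha> ^ (k * (2 ^ d - 1))"
    by (simp add: diff_mult_distrib2 flip: power_mult power_add)
  hence "\<alpha> ^ k \<in> sf d \<longleftrightarrow> \<alpha> ^ (k * (2 ^ d - 1)) = 1"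
    using \<alpha>_nonzero by (simp add: sf_def)
  also have "\<dots> \<longleftrightarrow> M d * (2 ^ d - 1) dvd k * (2 ^ d - 1)"
    by (simp only: \<alpha>_power_eq_1_iff M_mult[OF assms])
  also have "\<dots> \<longleftrightarrow> M d dvd k" using pos by simp
  finally show ?thesis .
qed

lemma card_sf: assumes d: "d dvd n" shows "card (sf d) = 2 ^ d"
proof -
  let ?m = "2 ^ d - (1::nat)"
  have pos: "0 < M d" using M_mult[OF d] N_pos by (metis mult_0 not_gr0)
  have lt: "M d * i < N \<longleftrightarrow> i < ?m" for i
    using pos by (simp only: flip: M_mult[OF d]) simp
  have "sf d = insert 0 ((\<lambda>i. \<alpha> ^ (M d * i)) ` {..<?m})"
  proof (intro equalityI subsetI)
    fix x assume x: "x \<in> sf d"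
    show "x \<in> insert 0 ((\<lambda>i. \<alpha> ^ (M d * i)) ` {..<?m})"
    proof (cases "x = 0")
      case False
      then obtain k where k: "k < N" "x = \<alpha> ^ k" by (rule nonzero_power)
      then obtain i where "k = M d * i" using x \<alpha>_power_sf_iff[OF d] by blast
      thus ?thesis using k lt by auto
    qed simp
  next
    fix x assume "x \<in> insert 0 ((\<lambda>i. \<alpha> ^ (M d * i)) ` {..<?m})"
    thus "x \<in> sf d" using zero_sf \<alpha>_power_sf_iff[OF d] by auto
  qed
  moreover have "inj_on (\<lambda>i. \<alpha> ^ (M d * i)) {..<?m}"
    by (rule inj_onI) (use pos lt in \<open>auto simp: \<alpha>_power_eq_iff\<close>)
  ultimately show ?thesis
    using \<alpha>_nonzero by (auto simp: card_insert_if card_image)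
qed

text \<open>The product of \<open>M d\<close> and 2^d - 1 is the constant N, so divisibility of the
  cofactors \<open>M\<close> reverses that of the Mersenne numbers.\<close>

lemma M_dvd_M_iff: assumes "d dvd n" "e dvd n" shows "M e dvd M d \<longleftrightarrow> d dvd e"
proof -
  have eq: "M e * (2 ^ e - 1) = M d * (2 ^ d - 1)" using assms by (simp only: M_mult)
  have pos: "0 < M e * (2 ^ e - 1)" using assms N_pos by (simp only: M_mult)
  have "M e dvd M d \<longleftrightarrow> 2 ^ d - 1 dvd 2 ^ e - (1::nat)"
  proof
    assume "M e dvd M d"
    then obtain q where "M d = M e * q" by blast
    hence "M e * (2 ^ e - 1) = M e * (q * (2 ^ d - 1))" using eq by (simp only: mult.assoc)
    moreover have "M e \<noteq> 0" using pos by simp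
    ultimately have "2 ^ e - 1 = q * (2 ^ d - (1::nat))" by simp
    thus "2 ^ d - 1 dvd 2 ^ e - (1::nat)" by (metis dvd_triv_right)
  next
    assume "2 ^ d - 1 dvd 2 ^ e - (1::nat)"
    then obtain q where "2 ^ e - (1::nat) = (2 ^ d - 1) * q" by blast
    hence "(M e * q) * (2 ^ d - 1) = M d * (2 ^ d - 1)" using eq by (simp only: ac_simps)
    moreover have "0 < 2 ^ d - (1::nat)" using pos eq by (metis mult_0_right not_gr0)
    ultimately have "M e * q = M d" by simp
    thus "M e dvd M d" by (metis dvd_triv_left)
  qed
  thus ?thesis using mersenne_dvd_mersenne_iff[OF dvd_n_pos[OF assms(1)]] by simp
qed

text \<open>Inclusion need only be tested on the generator \<alpha>^(M d) of the nonzero elements of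
  \<open>sf d\<close>.\<close>

lemma sf_subset_iff: assumes "d dvd n" "e dvd n" shows "sf d \<subseteq> sf e \<longleftrightarrow> d dvd e"
proof -
  have "sf d \<subseteq> sf e \<longleftrightarrow> M e dvd M d"
  proof
    assume "sf d \<subseteq> sf e"
    thus "M e dvd M d" using \<alpha>_power_sf_iff[of _ "M d"] assms by (meson dvd_refl subsetD)
  next
    assume "M e dvd M d"
    show "sf d \<subseteq> sf e"
    proof
      fix x assume x: "x \<in> sf d"
      show "x \<in> sf e"
      proof (cases "x = 0")
        case False
        then obtain k where "x = \<alpha> ^ k" by (rule nonzero_power)
        thus ?thesis using x \<open>M e dvd M d\<close> assms by (auto simp: \<alpha>_power_sf_iff intro: dvd_trans)
      qed (simp add: zero_sf)
    qed
  qed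
  thus ?thesis using assms by (simp add: M_dvd_M_iff)
qed

lemma sf_eq_iff: "d dvd n \<Longrightarrow> e dvd n \<Longrightarrow> sf d = sf e \<longleftrightarrow> d = e"
  using sf_subset_iff[of d e] sf_subset_iff[of e d] by (auto intro: dvd_antisym)

lemma is_subfield_01: "is_subfield {0, 1::'a}"
  using uminus_same[of 1] by (auto simp: is_subfield_def add_eq_0_iff2)

text \<open>\<open>K\<close> is a binary space, so it has 2^d elements, and the whole field is a
  \<open>K\<close>-space, so d divides n. Each element of \<open>K\<close> is a fixed point of the
  d-fold Frobenius map, and equal cardinality finishes.\<close>

lemma subfield_eq_sf:
  assumes "is_subfield K" obtains d where "d dvd n" "K = sf d"
proof -
  interpret K: subfield K by unfold_locales fact
  interpret P: subfield "{0, 1::'a}" by unfold_locales (rule is_subfield_01)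
  have "K \<in> subspaces {0, 1}"
    using K.zero K.add by (auto simp: subspaces_def)
  then obtain d where d: "card K = 2 ^ d" using P.card_subspace by (auto simp: numeral_2_eq_2)
  have "UNIV \<in> subspaces K" by (simp add: subspaces_def)
  then obtain m where "CARD('a) = card K ^ m" using K.card_subspace by blast
  hence "(2::nat) ^ n = 2 ^ (d * m)" by (simp add: card_UNIV d power_mult)
  hence dvd: "d dvd n" by simp
  have "K \<subseteq> sf d"
  proof
    fix x assume x: "x \<in> K"
    show "x \<in> sf d"
    proof (cases "x = 0")
      case False
      \<comment> \<open>Fermat's argument: multiplication by \<open>x\<close> permutes the nonzero
        elements of \<open>K\<close>, so comparing their products gives
        \<open>x ^ card ?U = 1\<close>.\<close>
      let ?U = "K - {0}"
      have "bij_betw ((*) x) ?U ?U"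
        by (rule bij_betw_byWitness[where f' = "(*) (inverse x)"])
           (use False x K.mult K.inverse in auto)
      hence "(\<Prod>y\<in>?U. y) = (\<Prod>y\<in>?U. x * y)"
        by (rule prod.reindex_bij_betw[symmetric])
      also have "\<dots> = x ^ card ?U * (\<Prod>y\<in>?U. y)" by (simp add: prod.distrib)
      finally have "x ^ card ?U = 1" by simp
      moreover have "card K = Suc (card ?U)" using K.zero by (simp only: card_Suc_Diff1 finite)
      ultimately show ?thesis by (simp add: sf_def flip: d)
    qed (simp add: zero_sf)
  qed
  hence "K = sf d" by (intro card_subset_eq) (simp_all add: d card_sf[OF dvd])
  thus thesis using dvd that by blast
qed

section \<open>Subspaces sorted by multiplier field\<close>

lemma is_subfield_stab: "V \<in> subspaces {0, 1} \<Longrightarrow> is_subfield (stab V)"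
  by (auto simp: is_subfield_def stab_def subspaces_def distrib_right mult.assoc)

definition stab_class :: "nat \<Rightarrow> 'a set set" where
  "stab_class d = {V \<in> subspaces {0, 1}. stab V = sf d}"

lemma subspaces_eq_UN: "subspaces {0, 1} = (\<Union>d\<in>{d. d dvd n}. stab_class d)"
proof (intro equalityI subsetI)
  fix V :: "'a set" assume V: "V \<in> subspaces {0, 1}"
  obtain d where "d dvd n" "stab V = sf d" using subfield_eq_sf[OF is_subfield_stab[OF V]] .
  thus "V \<in> (\<Union>d\<in>{d. d dvd n}. stab_class d)" using V by (auto simp: stab_class_def)
qed (auto simp: stab_class_def)

lemma stab_class_disjoint:
  "d dvd n \<Longrightarrow> e dvd n \<Longrightarrow> d \<noteq> e \<Longrightarrow> stab_class d \<inter> stab_class e = {}"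
  using sf_eq_iff by (auto simp: stab_class_def)

lemma finite_divisors: "finite {d. d dvd n}"
  using n_gt by (intro finite_divisors_nat) simp

text \<open>A binary subspace is a space over \<open>sf d\<close> exactly when its multiplier field
  is some \<open>sf e\<close> with d dividing e. These equations are the sieve.\<close>

lemma sum_card_stab_class:
  assumes d: "d dvd n"
  shows "(\<Sum>e | e dvd n \<and> d dvd e. of_nat (card (stab_class e))) =
         num_subspaces (n div d) (2 ^ d) + 1"
proof -
  interpret K: subfield "sf d" by unfold_locales (rule is_subfield_sf)
  have "subspaces (sf d) = (\<Union>e\<in>{e. e dvd n \<and> d dvd e}. stab_class e)"
  proof (rule set_eqI)
    fix V :: "'a set"
    have "V \<in> subspaces (sf d) \<longleftrightarrow> V \<in> subspaces {0, 1} \<and> sf d \<subseteq> stab V"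
      using K.zero K.one by (intro subspaces_iff_stab) auto
    also have "\<dots> \<longleftrightarrow> (\<exists>e. e dvd n \<and> V \<in> stab_class e \<and> sf d \<subseteq> sf e)"
      unfolding subspaces_eq_UN by (auto simp: stab_class_def)
    also have "\<dots> \<longleftrightarrow> V \<in> (\<Union>e\<in>{e. e dvd n \<and> d dvd e}. stab_class e)"
      using sf_subset_iff[OF d] by auto
    finally show "V \<in> subspaces (sf d) \<longleftrightarrow> V \<in> (\<Union>e\<in>{e. e dvd n \<and> d dvd e}. stab_class e)" .
  qed
  hence "card (subspaces (sf d)) = card (\<Union>e\<in>{e. e dvd n \<and> d dvd e}. stab_class e)" by simp
  also have "\<dots> = (\<Sum>e | e dvd n \<and> d dvd e. card (stab_class e))"
    using finite_divisors stab_class_disjoint by (intro card_UN_disjoint) auto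
  finally have "(\<Sum>e | e dvd n \<and> d dvd e. of_nat (card (stab_class e))) =
                (of_nat (card (subspaces (sf d))) :: rat)" by simp
  also have "\<dots> = num_subspaces (n div d) (2 ^ d) + 1"
    using K.card_subspaces[of "n div d"] d by (simp add: card_sf card_UNIV flip: power_mult)
  finally show ?thesis .
qed

end

section \<open>The index of a subcode\<close>

text \<open>Used with b = 3: it turns the condition on the exponent 3l into one on l.\<close>

lemma dvd_mult_iff_div_gcd_dvd:
  fixes a b c :: nat
  assumes "0 < a"
  shows "a dvd b * c \<longleftrightarrow> a div gcd b a dvd c"
proof -
  obtain a' b' where a: "a = a' * gcd b a" and b: "b = b' * gcd b a" and cop: "coprime b' a'"
    using gcd_coprime_exists[of b a] assms by auto
  have pos: "0 < gcd b a" using assms by simp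
  have "a dvd b * c \<longleftrightarrow> a' * gcd b a dvd b' * c * gcd b a"
    using a b by (metis mult.assoc mult.commute)
  also have "\<dots> \<longleftrightarrow> a' dvd b' * c" using pos by simp
  also have "\<dots> \<longleftrightarrow> a' dvd c" using cop by (simp add: coprime_commute coprime_dvd_mult_right_iff)
  also have "a' = a div gcd b a" using a pos by (metis nonzero_mult_div_cancel_right not_gr0)
  finally show ?thesis .
qed

context primitive_field
begin

section \<open>The trace and the cubic trace form\<close>

text \<open>The trace with its value left in the large field, where additivity and invariance under
  squaring are plain field arithmetic; \<open>of_bit\<close> links it to
  \<open>trace2\<close>.\<close>

definition tr :: "'a \<Rightarrow> 'a" where "tr x = (\<Sum>i<n. x ^ (2 ^ i))"

lemma tr_add: "tr (x + y) = tr x + tr y"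
proof -
  have "(x + y) ^ (2 ^ i) = x ^ (2 ^ i) + y ^ (2 ^ i)" for i
    by (rule freshmans_dream'[OF prime_CHAR]) (simp add: CHAR)
  thus ?thesis by (simp add: tr_def sum.distrib)
qed

lemma tr_zero: "tr 0 = 0"
  by (simp add: tr_def power_0_left)

lemma tr_square: "tr (x ^ 2) = tr x"
proof -
  have "tr (x ^ 2) = (\<Sum>i<n. x ^ (2 ^ Suc i))"
    by (simp add: tr_def flip: power_mult)
  also have "\<dots> = (\<Sum>i<Suc n. x ^ (2 ^ i)) - x"
    by (subst sum.lessThan_Suc_shift) simp
  also have "\<dots> = tr x"
    by (simp add: tr_def power_card)
  finally show ?thesis .
qed

text \<open>The trace is a polynomial of degree at most 2^(n-1), too small for 2^n roots; it is not
  the zero polynomial because its coefficient at X is 1.\<close>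

lemma exists_tr_nonzero: "\<exists>x. tr x \<noteq> 0"
proof (rule ccontr)
  assume "\<not> ?thesis"
  hence zero: "tr x = 0" for x by simp
  define p :: "'a poly" where "p = (\<Sum>i<n. monom 1 (2 ^ i))"
  have "coeff p 1 = (\<Sum>i<n. if i = 0 then 1 else 0)"
    unfolding p_def coeff_sum coeff_monom by (rule sum.cong) auto
  hence "p \<noteq> 0" using n_gt by auto
  hence "card {x. poly p x = 0} \<le> degree p" by (rule card_poly_roots_bound)
  moreover have "card {x. poly p x = 0} = 2 ^ n"
    using zero card_UNIV by (simp add: p_def tr_def poly_sum poly_monom)
  moreover have "degree p \<le> 2 ^ (n - 1)"
    unfolding p_def by (rule degree_sum_le) (auto simp: degree_monom_eq)
  ultimately have "(2::nat) ^ n \<le> 2 ^ (n - 1)" by linarith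
  moreover have "(2::nat) ^ (n - 1) < 2 ^ n" using n_gt by (intro power_strict_increasing) auto
  ultimately show False by linarith
qed

lemma tr_nondegenerate: assumes "\<And>x. tr (a * x) = 0" shows "a = 0"
proof (rule ccontr)
  assume "a \<noteq> 0"
  obtain y where y: "tr y \<noteq> 0" using exists_tr_nonzero by blast
  have "tr (a * (y / a)) = 0" by (rule assms)
  thus False using y \<open>a \<noteq> 0\<close> by simp
qed

lemma square_root: obtains y :: 'a where "z = y ^ 2"
proof
  have "(z ^ (2 ^ (n - 1))) ^ 2 = z ^ (2 ^ Suc (n - 1))" by (simp only: power_Suc2 flip: power_mult)
  thus "z = (z ^ (2 ^ (n - 1))) ^ 2" using n_gt power_card by simp
qed

text \<open>Polarization leaves a form that is additive in y; nondegeneracy turns its vanishing into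
  d^2 x^4 + d x = 0 for every x. A nonzero d would then make d x^3 = 1 for all nonzero x.\<close>

lemma tr_cubic_eq_0:
  assumes "\<And>x. tr (c * x + d * x ^ 3) = 0"
  shows "c = 0 \<and> d = 0"
proof -
  have four: "d ^ 2 * x ^ 4 + d * x = 0" for x
  proof (rule tr_nondegenerate)
    fix z :: 'a
    obtain y where z: "z = y ^ 2" by (rule square_root)
    let ?f = "\<lambda>x. c * x + d * x ^ 3"
    txt \<open>Polarization: the part of \<open>?f (x + y)\<close> that is not additive is \<open>d (x\<^sup>2 y + x y\<^sup>2)\<close>.\<close>
    have "d * x ^ 2 * y + d * x * y ^ 2 = ?f (x + y) - ?f x - ?f y -
        (2 * d * x ^ 2 * y + 2 * d * x * y ^ 2)"
      by (simp add: power2_eq_square power3_eq_cube algebra_simps)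
    moreover have "(2::'a) = 0" using of_nat_CHAR[where ?'a = 'a] by (simp add: CHAR)
    ultimately have "d * x ^ 2 * y + d * x * y ^ 2 = ?f (x + y) + ?f x + ?f y"
      by (simp add: minus_eq_plus)
    hence "tr (d * x ^ 2 * y + d * x * y ^ 2) = 0"
      by (simp only: tr_add assms) (simp add: assms flip: tr_add)
    \<comment> \<open>The two terms carry y and y^2. Squaring the first inside the trace makes both
      linear in z = y^2, and z is arbitrary since squaring is onto.\<close>
    moreover have "tr (d * x ^ 2 * y) = tr (d ^ 2 * x ^ 4 * z)"
      using tr_square[of "d * x ^ 2 * y"] by (simp add: z power_mult_distrib flip: power_mult)
    ultimately show "tr ((d ^ 2 * x ^ 4 + d * x) * z) = 0"
      by (simp add: distrib_right tr_add z)
  qed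
  have d: "d = 0"
  proof (rule ccontr)
    assume "d \<noteq> 0"
    have cube: "d * x ^ 3 = 1" if "x \<noteq> 0" for x
    proof -
      have "(d * x) * (d * x ^ 3) = (d * x) * 1"
        using four[of x]
        by (simp add: add_eq_0_iff2 uminus_same power2_eq_square power3_eq_cube power4_eq_xxxx mult_ac)
      thus ?thesis using that \<open>d \<noteq> 0\<close> by (simp only: mult_cancel_left) simp
    qed
    \<comment> \<open>Comparing x = 1 with x = \<alpha> forces \<alpha>^3 = 1, whereas \<alpha> has
      order N, at least 7.\<close>
    have "\<alpha> ^ 3 = 1" using cube[of 1] cube[OF \<alpha>_nonzero] by simp
    hence "N \<le> 3" by (auto simp: \<alpha>_power_eq_1_iff dest: dvd_imp_le)
    moreover have "(2::nat) ^ 3 \<le> 2 ^ n" using n_gt by (intro power_increasing) auto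
    ultimately show False by (simp add: N_def)
  qed
  moreover have "tr (c * x) = 0" for x
    using assms[of x] d by simp
  hence "c = 0" by (rule tr_nondegenerate)
  ultimately show ?thesis by simp
qed

section \<open>Codewords and subcodes in terms of their coefficients\<close>

lemma of_bit_eq_iff: "(of_bit a :: 'a) = of_bit b \<longleftrightarrow> a = b"
  by (cases a; cases b) auto

lemma of_bit_add: "(of_bit (a + b) :: 'a) = of_bit a + of_bit b"
  using uminus_same[of 1] by (cases a; cases b) (auto simp: add_eq_0_iff2)

lemma trace2_eq_iff: "trace2 n x = trace2 n y \<longleftrightarrow> tr x = tr (y :: 'a)"
  unfolding tr_def of_bit_trace2[OF card_UNIV, symmetric] of_bit_eq_iff ..

lemma trace2_add: "trace2 n (x + y) = trace2 n x + trace2 n (y :: 'a)"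
  using tr_add[of x y] unfolding tr_def of_bit_trace2[OF card_UNIV, symmetric]
  by (simp only: of_bit_eq_iff flip: of_bit_add)

lemma length_codeword: "length (codeword n \<alpha> a b) = N"
  by (simp add: codeword_def N_def)

lemma nth_codeword:
  "k < N \<Longrightarrow> codeword n \<alpha> a b ! k = trace2 n (a * \<alpha> ^ k + b * \<alpha> ^ (3 * k))"
  by (simp add: codeword_def N_def)

text \<open>The positions k < N run through all nonzero x = \<alpha>^k, so equal codewords make the
  cubic trace form of the coefficient differences vanish everywhere.\<close>

lemma codeword_eq_iff: "codeword n \<alpha> a b = codeword n \<alpha> a' b' \<longleftrightarrow> a = a' \<and> b = b'"
proof
  assume eq: "codeword n \<alpha> a b = codeword n \<alpha> a' b'"
  have "a + a' = 0 \<and> b + b' = 0"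
  proof (rule tr_cubic_eq_0)
    fix x :: 'a
    show "tr ((a + a') * x + (b + b') * x ^ 3) = 0"
    proof (cases "x = 0")
      case False
      then obtain k where k: "k < N" "x = \<alpha> ^ k" by (rule nonzero_power)
      have x3: "\<alpha> ^ (3 * k) = x ^ 3" by (simp add: k mult.commute flip: power_mult)
      have "trace2 n (a * x + b * x ^ 3) = trace2 n (a' * x + b' * x ^ 3)"
        using arg_cong[OF eq, of "\<lambda>w. w ! k"] k x3 by (simp add: nth_codeword)
      hence "tr (a * x + b * x ^ 3) + tr (a' * x + b' * x ^ 3) = 0"
        by (simp only: trace2_eq_iff add_eq_0_iff2 uminus_same)
      thus ?thesis by (simp add: algebra_simps flip: tr_add)
    qed (simp add: tr_zero)
  qed
  thus "a = a' \<and> b = b'" by (simp add: add_eq_0_iff2 uminus_same)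
qed simp

lemma codeword_add:
  "map2 (+) (codeword n \<alpha> a b) (codeword n \<alpha> a' b') = codeword n \<alpha> (a + a') (b + b')"
proof (rule nth_equalityI)
  fix k assume "k < length (map2 (+) (codeword n \<alpha> a b) (codeword n \<alpha> a' b'))"
  hence k: "k < N" by (simp add: length_codeword)
  have "(a * \<alpha> ^ k + b * \<alpha> ^ (3 * k)) + (a' * \<alpha> ^ k + b' * \<alpha> ^ (3 * k)) =
        (a + a') * \<alpha> ^ k + (b + b') * \<alpha> ^ (3 * k)"
    by (simp add: algebra_simps)
  thus "map2 (+) (codeword n \<alpha> a b) (codeword n \<alpha> a' b') ! k = codeword n \<alpha> (a + a') (b + b') ! k"
    using k by (simp add: length_codeword nth_codeword del: add_bit_eq_xor flip: trace2_add)
qed (simp add: length_codeword)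

lemma codeword_zero: "codeword n \<alpha> 0 0 = replicate N 0"
proof -
  have "trace2 n (0 :: 'a) = 0" using trace2_add[of 0 0] by simp
  thus ?thesis by (intro nth_equalityI) (simp_all add: length_codeword nth_codeword)
qed

lemma rotate_codeword:
  "rotate l (codeword n \<alpha> a b) = codeword n \<alpha> (\<alpha> ^ l * a) (\<alpha> ^ (3 * l) * b)"
proof (rule nth_equalityI)
  fix k assume "k < length (rotate l (codeword n \<alpha> a b))"
  hence k: "k < N" by (simp add: length_codeword)
  \<comment> \<open>Rotation reduces l + k modulo N before the multiplication by 3; pulling the cube
    outside lets the reduction be dropped.\<close>
  have "\<alpha> ^ (3 * ((l + k) mod N)) = (\<alpha> ^ ((l + k) mod N)) ^ 3"
    by (simp add: mult.commute flip: power_mult)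
  also have "\<dots> = \<alpha> ^ (3 * (l + k))"
    by (simp add: \<alpha>_power_mod mult.commute flip: power_mult)
  finally show "rotate l (codeword n \<alpha> a b) ! k =
                codeword n \<alpha> (\<alpha> ^ l * a) (\<alpha> ^ (3 * l) * b) ! k"
    using k N_pos
    by (simp add: nth_rotate length_codeword nth_codeword \<alpha>_power_mod power_add distrib_left mult_ac)
qed (simp add: length_codeword)

lemma codeword_in_subcode_iff: "codeword n \<alpha> a b \<in> subcode n \<alpha> V W \<longleftrightarrow> a \<in> V \<and> b \<in> W"
  by (auto simp: subcode_def codeword_eq_iff)

text \<open>Setting one coefficient to 0 isolates the subspace of the other.\<close>

lemma subcode_eq_iff:
  assumes "0 \<in> V" "0 \<in> W" "0 \<in> V'" "0 \<in> W'"
  shows "subcode n \<alpha> V W = subcode n \<alpha> V' W' \<longleftrightarrow> V = V' \<and> W = W'"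
proof
  assume "subcode n \<alpha> V W = subcode n \<alpha> V' W'"
  hence *: "a \<in> V \<and> b \<in> W \<longleftrightarrow> a \<in> V' \<and> b \<in> W'" for a b
    by (simp flip: codeword_in_subcode_iff)
  have "a \<in> V \<longleftrightarrow> a \<in> V'" "a \<in> W \<longleftrightarrow> a \<in> W'" for a
    using *[of a 0] *[of 0 a] assms by auto
  thus "V = V' \<and> W = W'" by auto
qed simp

lemma bit_subspace_iff: "bit_subspace V \<longleftrightarrow> V \<in> subspaces {0, 1::'a}"
proof -
  have "range (of_bit :: bit \<Rightarrow> 'a) = {0, 1}"
    using rangeI[of "of_bit :: bit \<Rightarrow> 'a" 0] rangeI[of "of_bit :: bit \<Rightarrow> 'a" 1] by auto
  hence "(\<forall>c. \<forall>x\<in>V. bit_scale c x \<in> V) \<longleftrightarrow> (\<forall>c\<in>{0,1}. \<forall>x\<in>V. c * x \<in> V)"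
    unfolding bit_scale_def by (metis (no_types, lifting) rangeE rangeI)
  thus ?thesis
    unfolding bit_subspace_def subspaces_def module.subspace_def[OF module_bit_scale[OF card_UNIV]]
    by auto
qed

lemma linear_code_subcode:
  assumes V: "V \<in> subspaces {0, 1}" and W: "W \<in> subspaces {0, 1}"
  shows "linear_code N (subcode n \<alpha> V W)"
proof -
  let ?D = "subcode n \<alpha> V W"
  have zero: "replicate N 0 \<in> ?D"
    using subspacesD(1)[OF V] subspacesD(1)[OF W] by (simp add: codeword_in_subcode_iff flip: codeword_zero)
  have word: "\<exists>a b. w = codeword n \<alpha> a b \<and> a \<in> V \<and> b \<in> W" if "w \<in> ?D" for w
    using that by (auto simp: subcode_def)
  have len: "length w = N" if "w \<in> ?D" for w
    using word[OF that] by (auto simp: length_codeword)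
  have "map2 (+) w w' \<in> ?D" if "w \<in> ?D" "w' \<in> ?D" for w w'
    using word[OF that(1)] word[OF that(2)] subspacesD(2)[OF V] subspacesD(2)[OF W]
    by (auto simp: codeword_add codeword_in_subcode_iff simp del: add_bit_eq_xor)
  moreover have "map ((*) a) w \<in> ?D" if "w \<in> ?D" for a w
  proof (cases a)
    case zero
    have "map ((*) 0) w = replicate N 0"
      using len[OF that] by (intro nth_equalityI) simp_all
    thus ?thesis using \<open>replicate N 0 \<in> ?D\<close> zero by simp
  next
    case one
    have "map ((*) 1) w = w" by (simp add: map_idI)
    thus ?thesis using that one by simp
  qed
  ultimately show ?thesis using zero len by (simp add: linear_code_def)
qed

lemma shift_invariant_subcode_iff:
  assumes V: "V \<in> subspaces {0, 1}" and W: "W \<in> subspaces {0, 1}"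
  shows "shift_invariant l (subcode n \<alpha> V W) \<longleftrightarrow> \<alpha> ^ l \<in> stab V \<and> \<alpha> ^ (3 * l) \<in> stab W"
proof -
  have "shift_invariant l (subcode n \<alpha> V W) \<longleftrightarrow>
        (\<forall>a\<in>V. \<forall>b\<in>W. \<alpha> ^ l * a \<in> V \<and> \<alpha> ^ (3 * l) * b \<in> W)"
  proof -
    have "shift_invariant l (subcode n \<alpha> V W) \<longleftrightarrow>
          (\<forall>a\<in>V. \<forall>b\<in>W. rotate l (codeword n \<alpha> a b) \<in> subcode n \<alpha> V W)"
      unfolding shift_invariant_def by (subst subcode_def) blast
    thus ?thesis by (simp only: rotate_codeword codeword_in_subcode_iff)
  qed
  thus ?thesis
    using subspacesD(1)[OF V] subspacesD(1)[OF W] by (auto simp: stab_def)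
qed

section \<open>The period of a pair and the general count\<close>

text \<open>For divisors d and e of n, the least positive l with \<open>M d dvd l\<close> and
  \<open>M e dvd 3 * l\<close>.\<close>

definition period :: "nat \<Rightarrow> nat \<Rightarrow> nat" where
  "period d e = lcm (M d) (M e div gcd 3 (M e))"

lemma M_pos: "d dvd n \<Longrightarrow> 0 < M d"
  using M_mult N_pos by (metis mult_0 not_gr0)

lemma period_pos: "d dvd n \<Longrightarrow> e dvd n \<Longrightarrow> 0 < period d e"
  using M_pos[of d] M_pos[of e] dvd_div_eq_0_iff[of "gcd 3 (M e)" "M e"]
  by (simp add: period_def lcm_pos_nat)

text \<open>The shifts that preserve the subcode are exactly the multiples of the period, whose
  least positive member is the period itself.\<close>

lemma quasi_cyclic_index_subcode_iff:
  assumes V: "V \<in> stab_class d" and W: "W \<in> stab_class e" and d: "d dvd n" and e: "e dvd n"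
  shows "quasi_cyclic_index N l (subcode n \<alpha> V W) \<longleftrightarrow> l = period d e"
proof -
  have VW: "V \<in> subspaces {0, 1}" "W \<in> subspaces {0, 1}" "stab V = sf d" "stab W = sf e"
    using V W by (auto simp: stab_class_def)
  have inv: "shift_invariant m (subcode n \<alpha> V W) \<longleftrightarrow> period d e dvd m" for m
    using dvd_mult_iff_div_gcd_dvd[OF M_pos[OF e], of 3 m]
    by (simp add: shift_invariant_subcode_iff VW \<alpha>_power_sf_iff d e period_def)
  show ?thesis
    using linear_code_subcode[OF VW(1,2)] period_pos[OF d e] unfolding quasi_cyclic_index_def inv
    by (meson dvd_imp_le dvd_refl le_neq_implies_less not_le)
qed

text \<open>Subcodes correspond bijectively to pairs (V, W). The summand for l = 1 restores the zero
  code, which the pairs include and \<open>qc_subcodes\<close> excludes.\<close>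

lemma card_qc_subcodes:
  "card (qc_subcodes n \<alpha> l) + (if l = 1 then 1 else 0) =
   (\<Sum>d | d dvd n. \<Sum>e | e dvd n.
     if period d e = l then card (stab_class d) * card (stab_class e) else 0)"
proof -
  let ?S = "subspaces {0, 1::'a}"
  define P where
    "P = {(V, W). V \<in> ?S \<and> W \<in> ?S \<and> quasi_cyclic_index N l (subcode n \<alpha> V W)}"
  define I where "I = {(d, e). d dvd n \<and> e dvd n \<and> period d e = l}"
  have finI: "finite I"
    by (rule finite_subset[of _ "{d. d dvd n} \<times> {d. d dvd n}"])
       (auto simp: I_def intro: finite_divisors)
  have "P = (\<Union>(d, e)\<in>I. stab_class d \<times> stab_class e)"
  proof (intro equalityI subsetI)
    fix p assume p: "p \<in> P"
    obtain V W where VW: "p = (V, W)" by (cases p)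
    have "V \<in> ?S" "W \<in> ?S" using p by (simp_all add: P_def VW)
    then obtain d e where "d dvd n" "e dvd n" "V \<in> stab_class d" "W \<in> stab_class e"
      unfolding subspaces_eq_UN by blast
    moreover from this have "period d e = l"
      using p by (simp add: P_def VW quasi_cyclic_index_subcode_iff)
    ultimately show "p \<in> (\<Union>(d, e)\<in>I. stab_class d \<times> stab_class e)"
      by (auto simp: I_def VW)
  next
    fix p assume "p \<in> (\<Union>(d, e)\<in>I. stab_class d \<times> stab_class e)"
    then obtain d e V W where "p = (V, W)" "d dvd n" "e dvd n" "period d e = l"
      "V \<in> stab_class d" "W \<in> stab_class e"
      by (auto simp: I_def)
    moreover from this have "V \<in> ?S" "W \<in> ?S" by (simp_all add: stab_class_def)
    ultimately show "p \<in> P" by (simp add: P_def quasi_cyclic_index_subcode_iff)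
  qed
  hence "card P = card (\<Union>p\<in>I. stab_class (fst p) \<times> stab_class (snd p))"
    by (simp add: case_prod_unfold)
  also have "\<dots> = (\<Sum>p\<in>I. card (stab_class (fst p) \<times> stab_class (snd p)))"
  proof (rule card_UN_disjoint[OF finI])
    show "\<forall>p\<in>I. \<forall>q\<in>I. p \<noteq> q \<longrightarrow>
      (stab_class (fst p) \<times> stab_class (snd p)) \<inter> (stab_class (fst q) \<times> stab_class (snd q)) = {}"
    proof (intro ballI impI)
      fix p q assume pq: "p \<in> I" "q \<in> I" "p \<noteq> q"
      hence "fst p \<noteq> fst q \<or> snd p \<noteq> snd q" by (simp add: prod_eq_iff)
      hence "stab_class (fst p) \<inter> stab_class (fst q) = {} \<or>
             stab_class (snd p) \<inter> stab_class (snd q) = {}"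
        using pq(1,2) stab_class_disjoint[of "fst p" "fst q"] stab_class_disjoint[of "snd p" "snd q"]
        by (auto simp: I_def)
      thus "(stab_class (fst p) \<times> stab_class (snd p)) \<inter> (stab_class (fst q) \<times> stab_class (snd q)) = {}"
        by auto
    qed
  qed simp
  \<comment> \<open>The sum is extended from the pairs of period l to all pairs of divisors, the new
    terms being 0.\<close>
  also have "\<dots> = (\<Sum>p\<in>{d. d dvd n} \<times> {e. e dvd n}.
      if period (fst p) (snd p) = l then card (stab_class (fst p)) * card (stab_class (snd p)) else 0)"
    by (rule sum.mono_neutral_cong_left)
       (auto simp: I_def finite_divisors card_cartesian_product)
  also have "\<dots> = (\<Sum>d | d dvd n. \<Sum>e | e dvd n.
      if period d e = l then card (stab_class d) * card (stab_class e) else 0)"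
    by (simp add: sum.cartesian_product case_prod_unfold)
  finally have card_P: "card P = \<dots>" .

  have zero: "{0} \<in> ?S" by (auto simp: subspaces_def)
  have sub0: "subcode n \<alpha> {0} {0} = {replicate N 0}"
    by (auto simp: subcode_def codeword_zero)
  have "quasi_cyclic_index N l {replicate N 0} \<longleftrightarrow> l = 1"
    using linear_code_subcode[OF zero zero]
    by (auto simp: sub0 quasi_cyclic_index_def shift_invariant_def)
  hence zero_P: "({0}, {0}) \<in> P \<longleftrightarrow> l = 1" by (simp add: P_def zero sub0)
  \<comment> \<open>The zero pair is inserted because removing the zero code from the image must
    commute with removing the zero pair, also when that pair is not in \<open>P\<close>.\<close>
  have inj: "inj_on (\<lambda>(V, W). subcode n \<alpha> V W) (insert ({0}, {0}) P)"
  proof (rule inj_on_subset)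
    show "inj_on (\<lambda>(V, W). subcode n \<alpha> V W) {(V, W). 0 \<in> V \<and> 0 \<in> W}"
      by (rule inj_onI) (auto simp: subcode_eq_iff)
  qed (auto simp: P_def dest: subspacesD(1))
  have "subcode n \<alpha> V W \<subseteq> dual_bch n \<alpha>" for V W
    by (auto simp: subcode_def dual_bch_def)
  hence "qc_subcodes n \<alpha> l = (\<lambda>(V, W). subcode n \<alpha> V W) ` P - {subcode n \<alpha> {0} {0}}"
    unfolding qc_subcodes_def P_def sub0 N_def[symmetric] bit_subspace_iff by auto
  also have "\<dots> = (\<lambda>(V, W). subcode n \<alpha> V W) ` (P - {({0}, {0})})"
    using inj_on_image_set_diff[OF inj, of P "{({0}, {0})}"] by auto
  finally have "card (qc_subcodes n \<alpha> l) = card (P - {({0}, {0})})"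
    using card_image[OF inj_on_subset[OF inj, of "P - {({0}, {0})}"]] by auto
  hence "card (qc_subcodes n \<alpha> l) + (if l = 1 then 1 else 0) = card P"
    using card_Suc_Diff1[of P "({0}, {0})"] zero_P by auto
  thus ?thesis using card_P by simp
qed

lemma dual_bch_in_qc_subcodes: "dual_bch n \<alpha> \<in> qc_subcodes n \<alpha> 1"
proof -
  have UNIV: "UNIV \<in> subspaces {0, 1::'a}" by (simp add: subspaces_def)
  have eq: "dual_bch n \<alpha> = subcode n \<alpha> UNIV UNIV"
    by (simp add: dual_bch_def subcode_def)
  have "subcode n \<alpha> UNIV UNIV \<noteq> subcode n \<alpha> {0} {0}"
    by (subst subcode_eq_iff) (auto dest: arg_cong[where f = "\<lambda>A. (1::'a) \<in> A"])
  moreover have "subcode n \<alpha> {0} {0} = {replicate N 0}"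
    by (auto simp: subcode_def codeword_zero)
  moreover have "quasi_cyclic_index N 1 (subcode n \<alpha> UNIV UNIV)"
    using linear_code_subcode[OF UNIV UNIV] shift_invariant_subcode_iff[OF UNIV UNIV]
    by (auto simp: quasi_cyclic_index_def stab_def)
  ultimately have "subcode n \<alpha> UNIV UNIV \<noteq> {replicate N 0} \<and>
      quasi_cyclic_index N 1 (subcode n \<alpha> UNIV UNIV)" by simp
  thus ?thesis
    using UNIV unfolding qc_subcodes_def eq N_def[symmetric] bit_subspace_iff mem_Collect_eq
    by blast
qed

end

section \<open>Products of two primes\<close>

lemma divisors_mult_primes:
  fixes u v :: nat
  assumes "prime u" "prime v"
  shows "{d. d dvd u * v} = {1, u, v, u * v}"
proof (intro equalityI subsetI)
  fix d assume "d \<in> {d. d dvd u * v}"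
  then obtain x y where "d = x * y" "x dvd u" "y dvd v"
    using division_decomp[of d u v] by auto
  moreover from this have "x \<in> {1, u}" "y \<in> {1, v}"
    using assms by (auto simp: prime_nat_iff)
  ultimately show "d \<in> {1, u, v, u * v}" by auto
qed auto

lemma num_subspaces_1: "1 < Q \<Longrightarrow> num_subspaces (Suc 0) Q = 1"
  by (simp add: num_subspaces_def)

text \<open>Rewrite rules that delete from the sums every pair whose period cannot be
  \<open>l\<close>.\<close>

lemma lcm_eq_iff_not_dvd:
  fixes a b l :: nat
  shows "\<not> a dvd l \<Longrightarrow> lcm a b = l \<longleftrightarrow> False" and "\<not> b dvd l \<Longrightarrow> lcm a b = l \<longleftrightarrow> False"
  by auto

section \<open>The four multiplier classes\<close>

locale two_primes = primitive_field +
  fixes u v :: nat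
  assumes prime_u: "prime u" and prime_v: "prime v" and u_neq_v: "u \<noteq> v" and n_eq: "n = u * v"
begin

lemma u_gt_1: "1 < u" and v_gt_1: "1 < v"
  using prime_u prime_v by (auto simp: prime_nat_iff)

lemma not_dvd: "\<not> u dvd v" "\<not> v dvd u"
  using prime_u prime_v u_neq_v by (auto simp: primes_dvd_imp_eq dest: primes_dvd_imp_eq)

lemma divisors: "{d. d dvd n} = {1, u, v, n}"
  unfolding n_eq using prime_u prime_v by (rule divisors_mult_primes)

lemma distinct_divisors: "1 \<noteq> u" "1 \<noteq> v" "u \<noteq> v" "1 \<noteq> n" "u \<noteq> n" "v \<noteq> n"
  using u_gt_1 v_gt_1 u_neq_v by (auto simp: n_eq)

lemma dvd_n: "1 dvd n" "u dvd n" "v dvd n" "n dvd n"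
  by (auto simp: n_eq)

abbreviation rcard :: "'b set \<Rightarrow> rat" where "rcard A \<equiv> of_nat (card A)"

text \<open>The sieve from the top: class n consists of {0} and the whole field, classes u and v are
  obtained by subtracting it, and class 1 by subtracting all three.\<close>

lemma card_stab_classes:
  "rcard (stab_class n) = 2"
  "rcard (stab_class u) = num_subspaces v (2 ^ u) - 1"
  "rcard (stab_class v) = num_subspaces u (2 ^ v) - 1"
  "rcard (stab_class 1) =
     num_subspaces (u * v) 2 - num_subspaces v (2 ^ u) - num_subspaces u (2 ^ v) + 1"
proof -
  have set: "{e. e dvd n \<and> d dvd e} = {e \<in> {1, u, v, n}. d dvd e}" for d
    using divisors by auto
  have "{e. e dvd n \<and> n dvd e} = {n}" by (auto intro: dvd_antisym)
  thus n: "rcard (stab_class n) = 2"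
    using sum_card_stab_class[of n] n_gt one_less_two_power[of n] by (simp add: num_subspaces_1)
  have "{e. e dvd n \<and> u dvd e} = {u, n}"
    unfolding set using not_dvd u_gt_1 dvd_n by auto
  thus u: "rcard (stab_class u) = num_subspaces v (2 ^ u) - 1"
    using sum_card_stab_class[of u] n u_gt_1 distinct_divisors by (simp add: n_eq)
  have "{e. e dvd n \<and> v dvd e} = {v, n}"
    unfolding set using not_dvd v_gt_1 dvd_n by auto
  thus v: "rcard (stab_class v) = num_subspaces u (2 ^ v) - 1"
    using sum_card_stab_class[of v] n v_gt_1 distinct_divisors by (simp add: n_eq)
  have "{e. e dvd n \<and> 1 dvd e} = {1, u, v, n}"
    unfolding set by auto
  thus "rcard (stab_class 1) =
     num_subspaces (u * v) 2 - num_subspaces v (2 ^ u) - num_subspaces u (2 ^ v) + 1"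
    using sum_card_stab_class[of 1] n u v distinct_divisors by (simp add: n_eq)
qed

text \<open>List sums unfold into sixteen explicit terms; the distinctness of the divisors is
  settled here once.\<close>

lemma card_qc_subcodes_two_primes:
  "of_nat (card (qc_subcodes n \<alpha> l)) + (if l = 1 then 1 else 0) =
   (\<Sum>d\<leftarrow>[1, u, v, n]. \<Sum>e\<leftarrow>[1, u, v, n].
      if period d e = l then rcard (stab_class d) * rcard (stab_class e) else 0)"
proof -
  have "of_nat (card (qc_subcodes n \<alpha> l)) + (if l = 1 then 1 else 0) =
        (of_nat (card (qc_subcodes n \<alpha> l) + (if l = 1 then 1 else 0)) :: rat)" by simp
  also have "\<dots> = (\<Sum>d\<in>{1, u, v, n}. \<Sum>e\<in>{1, u, v, n}.
      if period d e = l then rcard (stab_class d) * rcard (stab_class e) else 0)"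
    unfolding card_qc_subcodes divisors by (simp only: of_nat_sum of_nat_mult if_distrib of_nat_0)
  finally show ?thesis using distinct_divisors by (simp add: add.assoc)
qed

lemma M_1: "M 1 = N" and M_n: "M n = 1"
  using N_pos by (simp_all add: M_def N_def)

text \<open>The bound 3 ensures that \<open>M d\<close> stays above 1 even after losing a factor 3.
  A proper divisor satisfies 2d \<le> n, so M d \<le> 3 would give 2^n < 4 * 2^d, against 4 * 2^d
  \<le> 2^(2d) when d > 1.\<close>

lemma M_gt_3: assumes "d dvd n" "d \<noteq> n" shows "3 < M d"
proof -
  have n3: "(2::nat) ^ 3 \<le> 2 ^ n" using n_gt by (intro power_increasing) auto
  show ?thesis
  proof (cases "d = 1")
    case True
    thus ?thesis using n3 by (simp add: M_1 N_def del: One_nat_def)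
  next
    case False
    hence "1 < d" using dvd_n_pos[OF assms(1)] by simp
    hence d2: "(2::nat) ^ 2 \<le> 2 ^ d" by (intro power_increasing) auto
    obtain k where k: "n = d * k" using assms(1) by blast
    have "k \<noteq> 0" "k \<noteq> 1" using assms(2) n_gt k by (auto intro: Nat.gr0I)
    hence "d * 2 \<le> n" by (simp add: k)
    hence "(2::nat) ^ (d * 2) \<le> 2 ^ n" by (rule power_increasing) simp
    hence le: "(2 ^ d) * 2 ^ d \<le> (2::nat) ^ n" by (simp add: power_mult power2_eq_square)
    show ?thesis
    proof (rule ccontr)
      assume "\<not> 3 < M d"
      hence "N \<le> 3 * (2 ^ d - 1)"
        unfolding M_mult[OF assms(1), symmetric] by (intro mult_right_mono) auto
      moreover have "4 * 2 ^ d \<le> (2::nat) ^ d * 2 ^ d" using d2 by (intro mult_right_mono) auto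
      moreover have "4 \<le> (2::nat) ^ d" using d2 by simp
      ultimately show False using le unfolding N_def by linarith
    qed
  qed
qed

section \<open>Evaluation of the counts\<close>

text \<open>Period 1 forces both multiplier fields to be the whole field, which leaves four pairs,
  one of them the zero code.\<close>

lemma card_cyclic: "card (qc_subcodes n \<alpha> 1) = 3"
proof -
  have M: "M d \<noteq> 1" "M d div gcd 3 (M d) \<noteq> 1" if "d \<in> {1, u, v}" for d
  proof -
    have "d dvd n" "d \<noteq> n" using that dvd_n distinct_divisors by auto
    hence gt: "3 < M d" by (rule M_gt_3)
    thus "M d \<noteq> 1" by simp
    show "M d div gcd 3 (M d) \<noteq> 1"
    proof
      assume "M d div gcd 3 (M d) = 1"
      hence "M d = gcd 3 (M d)" by (metis dvd_div_mult_self gcd_dvd2 mult_1)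
      hence "M d dvd 3" by (metis gcd_dvd1)
      thus False using gt by (auto dest: dvd_imp_le)
    qed
  qed
  have "of_nat (card (qc_subcodes n \<alpha> 1)) + 1 = (4 :: rat)"
    using card_qc_subcodes_two_primes[of 1] M[of 1] M[of u] M[of v]
    by (simp add: period_def card_stab_classes(1) M_n del: One_nat_def)
  hence "of_nat (card (qc_subcodes n \<alpha> 1)) = (of_nat 3 :: rat)" by simp
  thus ?thesis by (simp only: of_nat_eq_iff)
qed

text \<open>For odd n, 2^n = 2 * 4^m is 2 modulo 3, so 3 does not divide N and all gcds are 1.
  Period \<open>M u\<close> then means that both fields are among \<open>sf u\<close> and
  \<open>sf n\<close>, not both being \<open>sf n\<close>.\<close>

lemma card_odd:
  assumes "odd u" "odd v"
  shows "of_nat (card (qc_subcodes n \<alpha> (M u))) =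
         2 * num_subspaces v (2 ^ u) + num_subspaces v (2 ^ u) ^ 2 - 3"
proof -
  have "odd n" using assms by (simp add: n_eq)
  then obtain m where m: "n = Suc (2 * m)" by (auto elim: oddE)
  have "(2::nat) ^ n mod 3 = 2 * ((2 ^ 2) ^ m mod 3) mod 3"
    by (simp add: m power_mult mod_mult_right_eq)
  also have "((2::nat) ^ 2) ^ m mod 3 = 1"
    by (subst power_mod[symmetric]) simp
  finally have "(2::nat) ^ n mod 3 = 2" by simp
  hence N3: "\<not> 3 dvd N" unfolding N_def by presburger
  have gcd: "gcd 3 (M d) = 1" if "d dvd n" for d
  proof -
    have "\<not> 3 dvd M d" using N3 M_mult[OF that] by (metis dvd_mult2)
    moreover have "prime (3::nat)" by simp
    ultimately show ?thesis by (meson coprime_iff_gcd_eq_1 prime_imp_coprime)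
  qed
  have "M u \<noteq> 1" using M_gt_3[of u] dvd_n distinct_divisors by simp
  moreover have "\<not> M 1 dvd M u" "\<not> M v dvd M u"
    using not_dvd u_gt_1 by (simp_all add: M_dvd_M_iff dvd_n del: One_nat_def)
  moreover from this have "M 1 \<noteq> M u" "M v \<noteq> M u" by (metis dvd_refl)+
  ultimately have "of_nat (card (qc_subcodes n \<alpha> (M u))) =
      rcard (stab_class u) * rcard (stab_class u) + rcard (stab_class u) * rcard (stab_class n) +
      rcard (stab_class n) * rcard (stab_class u)"
    using card_qc_subcodes_two_primes[of "M u"]
    by (simp add: period_def gcd dvd_n lcm_eq_iff_not_dvd M_n del: One_nat_def)
  also have "\<dots> = 2 * num_subspaces v (2 ^ u) + num_subspaces v (2 ^ u) ^ 2 - 3"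
    by (simp add: card_stab_classes power2_eq_square algebra_simps)
  finally show ?thesis .
qed

text \<open>With s = 2^v - 1 and 3t = 2^v + 1, the values of \<open>M\<close> at 1, u, v, n are 3st,
  st, 3t, 1, and the second coordinate contributes st, st, t, 1. So L2 = st, L3 = 3t and L3/3 =
  t.\<close>

lemma card_u_2:
  assumes u: "u = 2" and v: "odd v" "v \<noteq> 3"
  shows "of_nat (card (qc_subcodes n \<alpha> (M u))) =
           num_subspaces (u * v) 2 + num_subspaces v (2 ^ u)
           + num_subspaces (u * v) 2 * num_subspaces v (2 ^ u) - 2 * num_subspaces u (2 ^ v) - 1"
    (is ?L2)
  and "of_nat (card (qc_subcodes n \<alpha> (M v))) = num_subspaces u (2 ^ v) ^ 2 - 1" (is ?L3)
  and "of_nat (card (qc_subcodes n \<alpha> (M v div 3))) = 2 * num_subspaces u (2 ^ v) - 2" (is ?L3')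
proof -
  have "v mod 6 = 1 \<or> v mod 6 = 5"
  proof -
    have "\<not> 3 dvd v" using primes_dvd_imp_eq[of 3 v] prime_v v by auto
    thus ?thesis using \<open>odd v\<close> by presburger
  qed
  \<comment> \<open>The order of 2 modulo 9 is 6.\<close>
  moreover have "(2::nat) ^ v mod 9 = 2 ^ (v mod 6) mod 9"
  proof -
    have "(2::nat) ^ v = (2 ^ 6) ^ (v div 6) * 2 ^ (v mod 6)"
      by (simp only: flip: power_mult power_add) simp
    also have "\<dots> mod 9 = ((2 ^ 6) ^ (v div 6) mod 9) * 2 ^ (v mod 6) mod 9"
      by (simp only: mod_mult_left_eq)
    also have "((2::nat) ^ 6) ^ (v div 6) mod 9 = 1"
      by (subst power_mod[symmetric]) simp
    finally show ?thesis by simp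
  qed
  ultimately have "(2::nat) ^ v mod 9 = 2 \<or> (2::nat) ^ v mod 9 = 5" by auto
  \<comment> \<open>The residues 2 and 5 of 2^v modulo 9 make 2^v + 1 divisible by 3 but not by
    9.\<close>
  hence "\<exists>t::nat. 2 ^ v + 1 = 3 * t \<and> \<not> 3 dvd t \<and> \<not> 3 dvd (2 ^ v - (1::nat))" by presburger
  then obtain t :: nat where t: "2 ^ v + 1 = 3 * t" "\<not> 3 dvd t" "\<not> 3 dvd 2 ^ v - (1::nat)" by blast
  define s :: nat where "s = 2 ^ v - 1"
  have "3 < v" using v v_gt_1 by (cases "v = 2") auto
  hence v4: "(2::nat) ^ 4 \<le> 2 ^ v" by (intro power_increasing) auto
  hence s: "3 < s" "\<not> 3 dvd s" and t1: "1 < t" using t by (simp_all add: s_def)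
  have N: "N = s * (3 * t)"
  proof -
    have "(2::nat) ^ n = (2 ^ v) ^ 2" by (simp only: n_eq u mult.commute[of 2 v] power_mult)
    moreover have "2 ^ v = s + 1" "3 * t = s + 2" using t(1) by (simp_all add: s_def)
    ultimately show ?thesis unfolding N_def by (simp add: power2_eq_square)
  qed
  have M1: "M 1 = s * (3 * t)" by (simp only: M_1 N)
  have Mv: "M v = 3 * t"
  proof -
    have "s * M v = s * (3 * t)"
      using M_mult[OF dvd_n(3)] by (simp only: N s_def[symmetric] mult.commute)
    thus ?thesis using s by simp
  qed
  have Mu: "M u = s * t"
    using M_mult[OF dvd_n(2)] by (simp add: N u)
  have b: "M 1 div gcd 3 (M 1) = s * t" "M u div gcd 3 (M u) = s * t" "M v div gcd 3 (M v) = t"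
  proof -
    have "\<not> 3 dvd s * t" using s t by (simp add: prime_dvd_mult_iff)
    hence "coprime 3 (s * t)" using prime_imp_coprime[of 3 "s * t"] by simp
    thus "M u div gcd 3 (M u) = s * t" by (simp add: Mu coprime_iff_gcd_eq_1)
    have "gcd 3 (M 1) = 3" "gcd 3 (M v) = 3"
      unfolding M1 Mv by (auto intro!: gcd_proj1_if_dvd[of 3, simplified] dvd_mult)
    thus "M 1 div gcd 3 (M 1) = s * t" "M v div gcd 3 (M v) = t"
      by (simp_all add: M1 Mv del: One_nat_def)
  qed
  \<comment> \<open>These decide which lcms can equal st, 3t or t; most rest on size, but 3t not
    dividing st uses that 3 does not divide s.\<close>
  have nd: "\<not> s * (3 * t) dvd s * t" "\<not> s * (3 * t) dvd 3 * t" "\<not> s * (3 * t) dvd t"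
    "\<not> 3 * t dvd s * t" "\<not> 3 * t dvd t" "\<not> s * t dvd 3 * t" "\<not> s * t dvd t"
    using s t1 by (auto dest: dvd_imp_le)
  have ne: "t \<noteq> 1" "3 * t \<noteq> 1" "s * t \<noteq> 1" "t \<noteq> 3 * t" "t \<noteq> s * t" "s * (3 * t) \<noteq> s * t"
    "s * (3 * t) \<noteq> 3 * t" "s * (3 * t) \<noteq> t" "3 * t \<noteq> s * t" "s \<noteq> 0" "t \<noteq> 0" "s \<noteq> Suc 0" "s \<noteq> 3"
    using s t1 by auto
  have lcm: "lcm (s * t) t = s * t" "lcm (3 * t) t = 3 * t"
    by (auto intro: lcm_proj1_if_dvd)
  have period: "period d 1 = lcm (M d) (s * t)" "period d u = lcm (M d) (s * t)"
    "period d v = lcm (M d) t" "period d n = M d" for d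
    by (simp_all add: period_def b M_n del: One_nat_def)
  have "of_nat (card (qc_subcodes n \<alpha> (M u))) =
      rcard (stab_class u) * (rcard (stab_class 1) + rcard (stab_class u) +
        rcard (stab_class v) + rcard (stab_class n)) +
      rcard (stab_class n) * (rcard (stab_class 1) + rcard (stab_class u))"
    using card_qc_subcodes_two_primes[of "s * t"]
    by (simp add: period s lcm_eq_iff_not_dvd M_n M1 Mu Mv nd ne lcm algebra_simps del: One_nat_def)
  thus ?L2 unfolding card_stab_classes by (simp add: algebra_simps)
  have "of_nat (card (qc_subcodes n \<alpha> (M v))) =
      rcard (stab_class v) * rcard (stab_class v) + rcard (stab_class v) * rcard (stab_class n)"
    using card_qc_subcodes_two_primes[of "3 * t"]
    by (simp add: period s lcm_eq_iff_not_dvd M_n M1 Mu Mv nd ne lcm del: One_nat_def)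
  thus ?L3 by (simp add: card_stab_classes power2_eq_square algebra_simps)
  have "of_nat (card (qc_subcodes n \<alpha> (M v div 3))) = rcard (stab_class n) * rcard (stab_class v)"
    using card_qc_subcodes_two_primes[of t]
    by (simp add: period s lcm_eq_iff_not_dvd M_n M1 Mu Mv nd ne lcm del: One_nat_def)
  thus ?L3' by (simp add: card_stab_classes algebra_simps)
qed

text \<open>Here N = 63 is divisible by 9, so \<open>M u\<close> = 21 also loses a factor 3: the
  second coordinate contributes 21, 7, 3, 1 while the first contributes 63, 21, 9, 1.\<close>

lemma card_2_3:
  assumes u: "u = 2" and v: "v = 3"
  shows "card (qc_subcodes n \<alpha> 21) = 124194" "card (qc_subcodes n \<alpha> 9) = 99"
    "card (qc_subcodes n \<alpha> 7) = 84" "card (qc_subcodes n \<alpha> 3) = 18"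
proof -
  have NS: "num_subspaces 3 4 = 43" "num_subspaces 2 8 = 10" "num_subspaces 6 2 = 2824"
    by (simp_all add: num_subspaces_def numeral_eq_Suc)
  have "M d = 63 div (2 ^ d - 1)" for d
    unfolding M_def N_def by (simp add: n_eq u v)
  from this[of 1] this[of u] this[of v] M_n
  have M: "M 1 = 63" "M u = 21" "M v = 9" "M n = 1"
    by (simp_all add: u v del: One_nat_def)
  have c: "rcard (stab_class 1) = 2772" "rcard (stab_class u) = 42"
    "rcard (stab_class v) = 9" "rcard (stab_class n) = 2"
    unfolding card_stab_classes by (simp_all add: u v NS)
  have l: "lcm 63 21 = (63::nat)" "lcm 63 7 = (63::nat)" "lcm 63 3 = (63::nat)"
    "lcm 21 7 = (21::nat)" "lcm 21 3 = (21::nat)"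
    "lcm 9 21 = (63::nat)" "lcm 9 7 = (63::nat)" "lcm 9 3 = (9::nat)"
    by (simp_all add: lcm_nat_def gcd_non_0_nat)
  note * = card_qc_subcodes_two_primes
  have "of_nat (card (qc_subcodes n \<alpha> 21)) = (of_nat 124194 :: rat)"
    using *[of 21] by (simp add: period_def M c l del: One_nat_def)
  thus "card (qc_subcodes n \<alpha> 21) = 124194" by (simp only: of_nat_eq_iff)
  have "of_nat (card (qc_subcodes n \<alpha> 9)) = (of_nat 99 :: rat)"
    using *[of 9] by (simp add: period_def M c l del: One_nat_def)
  thus "card (qc_subcodes n \<alpha> 9) = 99" by (simp only: of_nat_eq_iff)
  have "of_nat (card (qc_subcodes n \<alpha> 7)) = (of_nat 84 :: rat)"
    using *[of 7] by (simp add: period_def M c l del: One_nat_def)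
  thus "card (qc_subcodes n \<alpha> 7) = 84" by (simp only: of_nat_eq_iff)
  have "of_nat (card (qc_subcodes n \<alpha> 3)) = (of_nat 18 :: rat)"
    using *[of 3] by (simp add: period_def M c l del: One_nat_def)
  thus "card (qc_subcodes n \<alpha> 3) = 18" by (simp only: of_nat_eq_iff)
qed

end

theorem theorem5p4:
  fixes \<alpha> :: "'a::finite_field" and u v n L2 L3 :: nat
  assumes "prime u" and "prime v" and "u \<noteq> v"
    and "n = u * v"
    and "CARD('a) = 2 ^ n"
    and "primitive_elem \<alpha>"
    and "L2 = (2 ^ (u * v) - 1) div (2 ^ u - 1)"
    and "L3 = (2 ^ (u * v) - 1) div (2 ^ v - 1)"
  shows "(dual_bch n \<alpha> \<in> qc_subcodes n \<alpha> 1 \<and> card (qc_subcodes n \<alpha> 1) = 3) \<and>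
    (odd u \<and> odd v \<longrightarrow>
       of_nat (card (qc_subcodes n \<alpha> L2)) =
         2 * num_subspaces v (2 ^ u) + num_subspaces v (2 ^ u) ^ 2 - 3 \<and>
       of_nat (card (qc_subcodes n \<alpha> L3)) =
         2 * num_subspaces u (2 ^ v) + num_subspaces u (2 ^ v) ^ 2 - 3) \<and>
    (u = 2 \<and> v \<noteq> 3 \<and> odd v \<longrightarrow>
       of_nat (card (qc_subcodes n \<alpha> L2)) =
         num_subspaces (u * v) 2 + num_subspaces v (2 ^ u)
         + num_subspaces (u * v) 2 * num_subspaces v (2 ^ u)
         - 2 * num_subspaces u (2 ^ v) - 1 \<and>
       of_nat (card (qc_subcodes n \<alpha> L3)) = num_subspaces u (2 ^ v) ^ 2 - 1 \<and>
       of_nat (card (qc_subcodes n \<alpha> (L3 div 3))) = 2 * num_subspaces u (2 ^ v) - 2) \<and>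
    (u = 2 \<and> v = 3 \<longrightarrow>
       card (qc_subcodes n \<alpha> 21) = 124194 \<and>
       card (qc_subcodes n \<alpha> 9) = 99 \<and>
       card (qc_subcodes n \<alpha> 7) = 84 \<and>
       card (qc_subcodes n \<alpha> 3) = 18)"
proof -
  have gt1: "1 < u" "1 < v" using assms(1,2) by (auto simp: prime_nat_iff)
  have "2 * 2 \<le> u * v" using gt1 by (intro mult_le_mono) auto
  hence n_gt: "2 < n" by (simp add: assms(4))
  interpret two_primes \<alpha> n u v
    by unfold_locales (use assms n_gt in auto)
  \<comment> \<open>The locale is symmetric in the two primes; exchanging them turns the odd count
    for L2 into that for L3.\<close>
  interpret swap: two_primes \<alpha> n v u
    by unfold_locales (use assms n_gt in auto)
  have L: "L2 = M u" "L3 = M v"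
    unfolding M_def N_def assms(7,8) by (simp_all add: assms(4))
  show ?thesis
    using dual_bch_in_qc_subcodes card_cyclic card_odd swap.card_odd card_u_2 card_2_3
    unfolding L by blast
qed

end
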